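(* For each $\varepsilon\in(0,1/2)$ there is $c_\varepsilon>0$ such that for all positive integers $k,\ell$ with $\ell/k\in[\varepsilon,1]$ and $\ell\ge c_\varepsilon^{-1}$, \[R(k+1,\ell+1)\le e^{-c_\varepsilon(\log k)^2}\binom{k+\ell}{k}.\]
   Context: For positive integers $k,\ell$, the Ramsey number $R(k,\ell)$ is the smallest positive integer $n$ such that every graph on $n$ vertices contains a clique of size $k$ or an independent set of size $\ell$. $\log$ denotes the natural logarithm. *)

theory Defs
  imports "HOL-Analysis.Analysis"
begin

text \<open>A simple graph on vertex set V is given by a symmetric edge relation E
  (loops are irrelevant since cliques/independent sets only look at distinct pairs).\<close>

definition is_clique :: "(nat \<Rightarrow> nat \<Rightarrow> bool) \<Rightarrow> nat set \<Rightarrow> bool" where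
  "is_clique E S \<longleftrightarrow> (\<forall>x\<in>S. \<forall>y\<in>S. x \<noteq> y \<longrightarrow> E x y)"

definition is_indep :: "(nat \<Rightarrow> nat \<Rightarrow> bool) \<Rightarrow> nat set \<Rightarrow> bool" where
  "is_indep E S \<longleftrightarrow> (\<forall>x\<in>S. \<forall>y\<in>S. x \<noteq> y \<longrightarrow> \<not> E x y)"

definition ramsey_prop :: "nat \<Rightarrow> nat \<Rightarrow> nat \<Rightarrow> bool" where
  "ramsey_prop k l n \<longleftrightarrow>
     (\<forall>E :: nat \<Rightarrow> nat \<Rightarrow> bool. (\<forall>x y. E x y = E y x) \<longrightarrow>
        (\<exists>S \<subseteq> {0..<n}. card S = k \<and> is_clique E S) \<or>
        (\<exists>S \<subseteq> {0..<n}. card S = l \<and> is_indep E S))"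

definition ramsey_number :: "nat \<Rightarrow> nat \<Rightarrow> nat" where
  "ramsey_number k l = (LEAST n. n > 0 \<and> ramsey_prop k l n)"

end

theory Submission
  imports Defs "HOL-Real_Asymp.Real_Asymp"
begin

text \<open>The bound holds even with an exponential gain \<open>exp (- c * k)\<close>. The two-colour version of the
  book algorithm of Balister, Bollobas, Campos, Griffiths, Hurley, Morris, Sahasrabudhe and Tiba
  finds, in a colouring whose degrees in colour \<open>i\<close> are all at least about \<open>q i * card W\<close>, a
  monochromatic clique \<open>A\<close> of size \<open>t\<close>, linear in \<open>k\<close>, joined in its own colour \<open>i\<close> to a set \<open>B\<close>
  with about \<open>q i ^ t * card W\<close> elements. For \<open>q True = k / (k + l)\<close> and \<open>q False = l / (k + l)\<close> this
  beats the binomial coefficient required by the Erdos-Szekeres bound inside \<open>B\<close> by a factor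
  exponential in \<open>t^2 / k\<close>. The degree condition comes for free: while some vertex has degree at
  least \<open>(1 + \<eta>) * q i * card W\<close>, pass to its neighbourhood. Each such step gains a factor \<open>1 + \<eta>\<close>,
  and after a small linear number of steps the Erdos-Szekeres bound already suffices.\<close>

section \<open>Correlation of two Gram kernels\<close>

text \<open>The obstacle is that a pivot must keep rich neighbourhoods in both colours at once.
  Positivity of Gram kernels guarantees this for a fraction
  \<open>exp (- 15 - 9 * sqrt (\<mu> + 1))\<close> of the pairs, for some unknown \<mu>: a large
  loss occurs only with a large density boost, and boosts are limited because densities are at most
  1. A book of size \<open>t\<close> gains about \<epsilon> t^2 / (8 k) in the exponent, while every
  loss is linear in \<open>t\<close>, of order \<delta> t / \<epsilon> for a density slack \<delta>.
  This makes \<open>t\<close> proportional to \<delta> k / \<epsilon>^2. The threshold \<mu>0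
  between clique steps and boosts must lie well above 1 / \<delta>, so that boosts hardly shrink the
  pages of the book, and well below 1 / \<delta>^2, so that the loss in \<open>X\<close>, about t
  times the root of \<mu>0, stays below a small multiple of k; the power -3/2 of \<delta> lies in
  this window.\<close>

definition psd_on :: "'a set \<Rightarrow> ('a \<Rightarrow> 'a \<Rightarrow> real) \<Rightarrow> bool" where
  "psd_on X K \<longleftrightarrow> (\<forall>g. 0 \<le> (\<Sum>x\<in>X. \<Sum>y\<in>X. g x * g y * K x y))"

lemma psd_on_sum_nonneg:
  assumes "psd_on X K" shows "0 \<le> (\<Sum>x\<in>X. \<Sum>y\<in>X. K x y)"
  using assms unfolding psd_on_def by (auto dest: spec[of _ "\<lambda>_. 1"])

lemma psd_on_const: "c \<ge> 0 \<Longrightarrow> psd_on X (\<lambda>x y. c)"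
proof -
  assume "c \<ge> 0"
  have "(\<Sum>x\<in>X. \<Sum>y\<in>X. g x * g y * c) = c * (\<Sum>x\<in>X. g x)\<^sup>2" for g
    by (simp add: power2_eq_square sum_product sum_distrib_left mult_ac)
  then show ?thesis using \<open>c \<ge> 0\<close> by (simp add: psd_on_def)
qed

lemma psd_on_add: "psd_on X K \<Longrightarrow> psd_on X L \<Longrightarrow> psd_on X (\<lambda>x y. K x y + L x y)"
  by (auto simp: psd_on_def distrib_left sum.distrib add_nonneg_nonneg)

lemma psd_on_cmult:
  assumes "c \<ge> 0" "psd_on X K" shows "psd_on X (\<lambda>x y. c * K x y)"
proof -
  have "(\<Sum>x\<in>X. \<Sum>y\<in>X. g x * g y * (c * K x y)) = c * (\<Sum>x\<in>X. \<Sum>y\<in>X. g x * g y * K x y)" for g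
    by (simp add: sum_distrib_left mult_ac)
  then show ?thesis using assms by (simp add: psd_on_def)
qed

definition gram_on :: "'a set \<Rightarrow> 'b set \<Rightarrow> ('a \<Rightarrow> 'b \<Rightarrow> real) \<Rightarrow> ('a \<Rightarrow> 'a \<Rightarrow> real) \<Rightarrow> bool" where
  "gram_on X I \<phi> K \<longleftrightarrow> (\<forall>x\<in>X. \<forall>y\<in>X. K x y = (\<Sum>w\<in>I. \<phi> x w * \<phi> y w))"

text \<open>Schur product argument: in the expansion over \<open>w\<close> the factors
  \<open>\<phi> x w\<close> and \<open>\<phi> y w\<close> are absorbed into the weights
  \<open>g x\<close> and \<open>g y\<close>, leaving a sum of forms of \<open>L\<close>.\<close>

lemma psd_on_gram_mult:
  assumes "gram_on X I \<phi> K" "psd_on X L"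
  shows "psd_on X (\<lambda>x y. K x y * L x y)"
  unfolding psd_on_def
proof
  fix g :: "'a \<Rightarrow> real"
  have "(\<Sum>x\<in>X. \<Sum>y\<in>X. g x * g y * (K x y * L x y))
      = (\<Sum>x\<in>X. \<Sum>y\<in>X. \<Sum>w\<in>I. (g x * \<phi> x w) * (g y * \<phi> y w) * L x y)"
    using assms(1) unfolding gram_on_def
    by (intro sum.cong refl) (simp add: sum_distrib_left sum_distrib_right mult_ac)
  also have "\<dots> = (\<Sum>x\<in>X. \<Sum>w\<in>I. \<Sum>y\<in>X. (g x * \<phi> x w) * (g y * \<phi> y w) * L x y)"
    by (intro sum.cong refl sum.swap)
  also have "\<dots> = (\<Sum>w\<in>I. \<Sum>x\<in>X. \<Sum>y\<in>X. (g x * \<phi> x w) * (g y * \<phi> y w) * L x y)"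
    by (rule sum.swap)
  also have "\<dots> \<ge> 0"
    by (rule sum_nonneg) (use assms(2) in \<open>auto simp: psd_on_def dest: spec[of _ "\<lambda>x. g x * \<phi> x _"]\<close>)
  finally show "0 \<le> (\<Sum>x\<in>X. \<Sum>y\<in>X. g x * g y * (K x y * L x y))" .
qed

lemma psd_on_gram_power:
  assumes "gram_on X I \<phi> K" shows "psd_on X (\<lambda>x y. K x y ^ n)"
proof (induction n)
  case 0 show ?case using psd_on_const[of 1] by simp
next
  case (Suc n) then show ?case using psd_on_gram_mult[OF assms] by simp
qed

lemma psd_on_sums:
  assumes "finite X" "\<And>n. psd_on X (K n)"
    and sums: "\<And>x y. x \<in> X \<Longrightarrow> y \<in> X \<Longrightarrow> (\<lambda>n. K n x y) sums L x y"
  shows "psd_on X L"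
  unfolding psd_on_def
proof
  fix g :: "'a \<Rightarrow> real"
  have "(\<lambda>n. \<Sum>x\<in>X. \<Sum>y\<in>X. g x * g y * K n x y) sums (\<Sum>x\<in>X. \<Sum>y\<in>X. g x * g y * L x y)"
    by (intro sums_sum sums_mult sums)
  moreover have "0 \<le> (\<Sum>x\<in>X. \<Sum>y\<in>X. g x * g y * K n x y)" for n
    using assms(2) by (auto simp: psd_on_def)
  ultimately show "0 \<le> (\<Sum>x\<in>X. \<Sum>y\<in>X. g x * g y * L x y)"
    by (metis (no_types, lifting) sums_le sums_zero)
qed

section \<open>An entire function of order one half and the test function built from it\<close>

text \<open>Both branches have the power series with coefficients \<open>1 / fact (2 * n)\<close>.
  Nonnegative coefficients preserve positive semidefiniteness, the cosine branch is bounded, and the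
  growth \<open>exp (sqrt z)\<close> is the origin of the square roots in all later costs.\<close>

definition cosh_sqrt :: "real \<Rightarrow> real" where
  "cosh_sqrt z = (if z \<ge> 0 then cosh (sqrt z) else cos (sqrt (- z)))"

lemma cosh_sqrt_sums: "(\<lambda>n. z ^ n / fact (2 * n)) sums cosh_sqrt z"
proof (cases "z \<ge> 0")
  case True
  have "(\<lambda>n. if even n then sqrt z ^ n /\<^sub>R fact n else 0) sums cosh (sqrt z)"
    by (rule cosh_converges)
  then have "(\<lambda>n. sqrt z ^ (2*n) /\<^sub>R fact (2*n)) sums cosh (sqrt z)"
    by (subst (asm) sums_mono_reindex[of "\<lambda>n. 2*n", symmetric])
       (auto simp: strict_mono_def elim!: evenE)
  moreover have "sqrt z ^ (2*n) = z ^ n" for n using True by (simp add: power_mult)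
  ultimately show ?thesis using True by (simp add: cosh_sqrt_def divide_inverse mult.commute)
next
  case False
  have "(\<lambda>n. cos_coeff n *\<^sub>R sqrt (-z) ^ n) sums cos (sqrt (-z))"
    by (rule cos_converges)
  then have "(\<lambda>n. cos_coeff (2*n) *\<^sub>R sqrt (-z) ^ (2*n)) sums cos (sqrt (-z))"
    by (subst (asm) sums_mono_reindex[of "\<lambda>n. 2*n", symmetric])
       (auto simp: strict_mono_def cos_coeff_def elim!: evenE)
  moreover have "cos_coeff (2*n) *\<^sub>R sqrt (-z) ^ (2*n) = z ^ n / fact (2*n)" for n
  proof -
    have "sqrt (-z) ^ (2*n) = (-z) ^ n" using False by (simp add: power_mult)
    moreover have "(-1) ^ n * (-z) ^ n = z ^ n" by (metis minus_mult_minus mult_1 power_mult_distrib)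
    ultimately show ?thesis by (simp add: cos_coeff_def)
  qed
  ultimately show ?thesis using False by (simp add: cosh_sqrt_def)
qed

lemma cosh_sqrt_neg: "z \<le> 0 \<Longrightarrow> \<bar>cosh_sqrt z\<bar> \<le> 1"
  by (auto simp: cosh_sqrt_def)

lemma cosh_sqrt_ge: assumes "z \<ge> 0" shows "cosh_sqrt z \<ge> 1 + z / 2"
proof -
  have "(\<Sum>n<2. z ^ n / fact (2 * n)) \<le> cosh_sqrt z"
    using sum_le_suminf[OF sums_summable[OF cosh_sqrt_sums[of z]], of "{..<2}"] assms
    by (simp add: sums_unique[OF cosh_sqrt_sums, symmetric])
  then show ?thesis by (simp add: eval_nat_numeral)
qed

lemma cosh_sqrt_le: assumes "z \<le> M" "0 \<le> M" shows "cosh_sqrt z \<le> exp (sqrt M)"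
proof (cases "z \<ge> 0")
  case True
  have "cosh (sqrt z) \<le> exp (sqrt z)"
    using True by (simp add: cosh_field_def field_simps) 
  also have "\<dots> \<le> exp (sqrt M)" using assms by simp
  finally show ?thesis using True by (simp add: cosh_sqrt_def)
next
  case False
  then have "cosh_sqrt z \<le> 1" using cosh_sqrt_neg[of z] by simp
  also have "1 \<le> exp (sqrt M)" using assms by simp
  finally show ?thesis .
qed

text \<open>Expanding \<open>cosh_sqrt\<close> shows that \<open>test_fun\<close> has nonnegative Taylor coefficients, so its sum over
  two Gram kernels is nonnegative; yet it is at most \<open>-1\<close> as soon as one argument is below \<open>-6\<close>,
  and it grows only like \<open>exp (2 * sqrt M)\<close>. Hence the positive correlations cannot be rare.\<close>

definition test_fun :: "real \<Rightarrow> real \<Rightarrow> real" where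
  "test_fun x y = x * (2 + cosh_sqrt y) + y * (2 + cosh_sqrt x)"

lemma test_fun_commute: "test_fun x y = test_fun y x"
  by (simp add: test_fun_def)

text \<open>The constant 6 balances two slopes: for \<open>y > 0\<close> the first summand is at
  most \<open>-6 * (3 + y / 2)\<close>, whose part \<open>-3 * y\<close> cancels the bound
  \<open>3 * y\<close> on the second. For \<open>y \<le> 0\<close> the first is at most
  \<open>x\<close> and the second is nonpositive.\<close>

lemma test_fun_neg:
  assumes "x \<le> -6" shows "test_fun x y \<le> -1"
proof (cases "y \<le> 0")
  case True
  have "x * (2 + cosh_sqrt y) \<le> x * 1"
    using cosh_sqrt_neg[OF True] assms by (intro mult_left_mono_neg) auto
  then have "x * (2 + cosh_sqrt y) \<le> -6" using assms by linarith
  moreover have "y * (2 + cosh_sqrt x) \<le> 0"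
    using cosh_sqrt_neg[of x] True assms by (intro mult_nonpos_nonneg) auto
  ultimately show ?thesis unfolding test_fun_def by linarith
next
  case False
  have "x * (2 + cosh_sqrt y) \<le> x * (3 + y / 2)"
    using cosh_sqrt_ge[of y] False assms by (intro mult_left_mono_neg) auto
  also have "\<dots> \<le> (-6) * (3 + y / 2)"
    using False assms by (intro mult_right_mono) auto
  finally have "x * (2 + cosh_sqrt y) \<le> (-6) * (3 + y / 2)" .
  moreover have "y * (2 + cosh_sqrt x) \<le> y * 3"
    using cosh_sqrt_neg[of x] False assms by (intro mult_left_mono) auto
  ultimately show ?thesis by (simp add: test_fun_def)
qed

lemma test_fun_le:
  assumes "x \<le> M" "y \<le> M" "0 \<le> M" shows "test_fun x y \<le> 12 * exp (2 * sqrt M)"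
proof -
  have aux: "x * (2 + cosh_sqrt y) \<le> M * (3 * exp (sqrt M))" if "x \<le> M" "y \<le> M" for x y
  proof -
    have pos: "0 \<le> 2 + cosh_sqrt y"
      using cosh_sqrt_neg[of y] cosh_sqrt_ge[of y] by (cases "y \<le> 0") auto
    have "2 + cosh_sqrt y \<le> 3 * exp (sqrt M)"
      using cosh_sqrt_le[OF that(2) assms(3)] one_le_exp_iff[of "sqrt M"] assms(3) 
      by (smt (verit) real_sqrt_ge_zero)
    have "x * (2 + cosh_sqrt y) \<le> M * (2 + cosh_sqrt y)"
      using that pos by (intro mult_right_mono) auto
    also have "\<dots> \<le> M * (3 * exp (sqrt M))"
      using \<open>2 + cosh_sqrt y \<le> _\<close> assms(3) by (intro mult_left_mono) auto
    finally show ?thesis .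
  qed
  have "M \<le> 2 * exp (sqrt M)"
  proof -
    have "1 + sqrt M + M / 2 \<le> exp (sqrt M)"
      using exp_lower_Taylor_quadratic[of "sqrt M"] assms(3) by simp
    with real_sqrt_ge_zero[OF assms(3)] show ?thesis by linarith
  qed
  have "test_fun x y \<le> 2 * (M * (3 * exp (sqrt M)))"
    using aux[of x y] aux[of y x] assms by (simp add: test_fun_def)
  also have "\<dots> \<le> 2 * (2 * exp (sqrt M) * (3 * exp (sqrt M)))"
    using \<open>M \<le> _\<close> by (intro mult_left_mono mult_right_mono) auto
  also have "\<dots> = 12 * exp (2 * sqrt M)"
    by (simp add: exp_double power2_eq_square)
  finally show ?thesis .
qed

lemma psd_on_gram_mult_cosh_sqrt:
  assumes "finite X" "gram_on X I \<phi> K" "gram_on X J \<psi> L"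
  shows "psd_on X (\<lambda>x y. K x y * (2 + cosh_sqrt (L x y)))"
proof -
  have "psd_on X (\<lambda>x y. cosh_sqrt (L x y))"
  proof (rule psd_on_sums[OF assms(1) _ cosh_sqrt_sums])
    show "psd_on X (\<lambda>x y. L x y ^ n / fact (2 * n))" for n
      using psd_on_cmult[OF _ psd_on_gram_power[OF assms(3)], of "1 / fact (2*n)" n] by simp
  qed
  then show ?thesis
    by (intro psd_on_gram_mult[OF assms(2)] psd_on_add psd_on_const) auto
qed

lemma sum_test_fun_nonneg:
  assumes "finite X" "gram_on X I \<phi> K" "gram_on X J \<psi> L"
  shows "0 \<le> (\<Sum>x\<in>X. \<Sum>y\<in>X. test_fun (K x y) (L x y))"
  unfolding test_fun_def
  by (rule psd_on_sum_nonneg psd_on_add psd_on_gram_mult_cosh_sqrt[OF assms]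
      psd_on_gram_mult_cosh_sqrt[OF assms(1,3,2)])+

text \<open>The subtracted \<open>1 / real n\<close> makes the induction telescope. At
  \<open>n = 0\<close> it is 0 by the convention for division, so the step from 0 to 1 is checked
  separately.\<close>

lemma sum_inverse_squares_le: "(\<Sum>j<n. 1 / (real j + 1)\<^sup>2) \<le> 2 - 1 / real n"
proof (induction n)
  case (Suc n)
  show ?case
  proof (cases "n = 0")
    case False
    then have "1 / (real n + 1)\<^sup>2 \<le> 1 / real n - 1 / (real n + 1)"
      by (simp add: divide_simps power2_eq_square)
    with Suc show ?thesis by (simp add: add.commute)
  qed simp
qed simp

lemma gram_on_cmult:
  assumes "c \<ge> 0" "gram_on X I \<phi> K"
  shows "gram_on X I (\<lambda>x w. sqrt c * \<phi> x w) (\<lambda>x y. c * K x y)"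
proof -
  have eq: "sqrt c * a * (sqrt c * b) = c * (a * b)" for a b
  proof -
    have "sqrt c * a * (sqrt c * b) = (sqrt c * sqrt c) * (a * b)" by (simp only: mult_ac)
    then show ?thesis using assms(1) by simp
  qed
  show ?thesis using assms(2) unfolding gram_on_def eq by (simp add: sum_distrib_left)
qed

lemma exp_neg_sqrt_le:
  assumes "s > 0" shows "exp (-4 * sqrt s) \<le> 1 / s\<^sup>2"
proof -
  have "sqrt s \<le> exp (sqrt s)" using exp_ge_add_one_self[of "sqrt s"] by linarith
  then have "sqrt s ^ 4 \<le> exp (sqrt s) ^ 4" using assms by (intro power_mono) auto
  also have "\<dots> = exp (4 * sqrt s)" by (simp flip: exp_of_nat_mult)
  also have "sqrt s ^ 4 = s\<^sup>2" using assms by (simp add: power4_eq_xxxx power2_eq_square)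
  finally have "s\<^sup>2 \<le> exp (4 * sqrt s)" .
  then have "1 / exp (4 * sqrt s) \<le> 1 / s\<^sup>2" using assms by (intro divide_left_mono) auto
  then show ?thesis by (simp add: exp_minus inverse_eq_divide)
qed

text \<open>If all these sets of pairs were too small, the sum of \<open>test_fun\<close> over all
  pairs would be negative. Pairs with some correlation below -1 contribute at most -1 each and are
  nearly all pairs. The others are summed by levels \<open>j\<close>, where the growth
  \<open>exp (5 * sqrt (j + 1))\<close> meets the rarity \<open>exp (-9 * sqrt (j + 1))\<close> with
  a summable product.\<close>

lemma exists_correlated_colour:
  fixes K :: "bool \<Rightarrow> 'a \<Rightarrow> 'a \<Rightarrow> real"
  assumes fin: "finite X" and ne: "X \<noteq> {}"
    and gram: "\<And>i. gram_on X (I i) (\<phi> i) (K i)"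
  obtains i \<mu> where "\<mu> \<ge> -1"
    "exp (-15 - 9 * sqrt (\<mu> + 1)) * (real (card X))\<^sup>2
      \<le> card {z \<in> X \<times> X. \<mu> \<le> K i (fst z) (snd z) \<and> -1 \<le> K (\<not> i) (fst z) (snd z)}"
proof (rule ccontr)
  note witness = that
  define A where "A i \<mu> = {z \<in> X \<times> X. \<mu> \<le> K i (fst z) (snd z) \<and> -1 \<le> K (\<not> i) (fst z) (snd z)}"
    for i and \<mu> :: real
  define N where "N = (real (card X))\<^sup>2"
  assume "\<not> thesis"
  then have small: "card (A i \<mu>) < exp (-15 - 9 * sqrt (\<mu> + 1)) * N" if "\<mu> \<ge> -1" for i \<mu>
    using witness[OF that, of i] \<open>\<not> thesis\<close> unfolding A_def N_def by (meson not_le)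
  define P where "P = X \<times> X"
  have finP: "finite P" and cardP: "real (card P) = N"
    using fin by (auto simp: P_def N_def card_cartesian_product power2_eq_square)
  have Npos: "N > 0" using fin ne by (simp add: N_def card_gt_0_iff)
  define K' where "K' i z = K i (fst z) (snd z)" for i z
  \<comment> \<open>Scaling by 6 moves the threshold -6 of \<open>test_fun_neg\<close> to
    -1.\<close>
  define F where "F z = test_fun (6 * K' True z) (6 * K' False z)" for z
  define E where "E = {z \<in> P. -1 \<le> K' True z \<and> -1 \<le> K' False z}"
  define m where "m z = nat \<lfloor>max (max (K' True z) (K' False z)) 0\<rfloor>" for z
  define J where "J = Suc (Max (insert 0 (m ` E)))"
  have finE: "finite E" "E \<subseteq> P" using finP by (auto simp: E_def)
  have cardE: "real (card E) \<le> exp (-15) * N"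
    using small[of "-1" True] by (simp add: A_def E_def P_def K'_def)

  have "0 \<le> (\<Sum>x\<in>X. \<Sum>y\<in>X. test_fun (6 * K True x y) (6 * K False x y))"
    by (rule sum_test_fun_nonneg[OF fin gram_on_cmult[OF _ gram] gram_on_cmult[OF _ gram]]) auto
  also have "\<dots> = sum F P"
    by (simp add: F_def P_def K'_def sum.cartesian_product case_prod_unfold)
  also have "\<dots> = sum F (P - E) + sum F E"
    using finP finE by (metis sum.subset_diff)
  finally have nonneg: "0 \<le> sum F (P - E) + sum F E" .

  have "sum F (P - E) \<le> (\<Sum>z\<in>P - E. -1)"
  proof (rule sum_mono)
    fix z assume "z \<in> P - E"
    then have "K' True z \<le> -1 \<or> K' False z \<le> -1" by (auto simp: E_def)
    then show "F z \<le> -1"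
      using test_fun_neg[of "6 * K' True z" "6 * K' False z"]
        test_fun_neg[of "6 * K' False z" "6 * K' True z"]
        test_fun_commute[of "6 * K' True z" "6 * K' False z"]
      by (auto simp: F_def)
  qed
  also have "\<dots> = real (card E) - N"
    using finE finP cardP by (simp add: card_Diff_subset card_mono of_nat_diff)
  finally have out: "sum F (P - E) \<le> exp (-15) * N - N" using cardE by linarith

  \<comment> \<open>The constant -15 is weakened to -6 so that level 0, where only the bound
    \<open>exp (-15) * N\<close> on \<open>card E\<close> is available, obeys the same formula: -6 -
    9 = -15.\<close>
  have card_level: "card {z \<in> E. m z = j} \<le> 2 * exp (-6 - 9 * sqrt (real j + 1)) * N" for j
  proof (cases "j = 0")
    case True
    have "card {z \<in> E. m z = j} \<le> card E" using finE by (auto intro: card_mono)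
    then show ?thesis using cardE True Npos by simp
  next
    case False
    have "{z \<in> E. m z = j} \<subseteq> A True j \<union> A False j"
    proof
      fix z assume z: "z \<in> {z \<in> E. m z = j}"
      have "real j \<le> max (max (K' True z) (K' False z)) 0"
        using z unfolding m_def by (auto simp: le_floor_iff)
      then show "z \<in> A True j \<union> A False j"
        using z False by (auto simp: A_def E_def P_def K'_def max_def split: if_splits)
    qed
    then have "card {z \<in> E. m z = j} \<le> card (A True j \<union> A False j)"
      using fin by (intro card_mono) (auto simp: A_def)
    also have "\<dots> \<le> card (A True j) + card (A False j)" by (rule card_Un_le)
    finally have "real (card {z \<in> E. m z = j}) \<le> 2 * (exp (-15 - 9 * sqrt (real j + 1)) * N)"
      using small[of "real j" True] small[of "real j" False] by linarith
    also have "\<dots> \<le> 2 * (exp (-6 - 9 * sqrt (real j + 1)) * N)"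
      using Npos by (intro mult_left_mono mult_right_mono) auto
    finally show ?thesis by simp
  qed

  have "sum F E \<le> (\<Sum>z\<in>E. 12 * exp (5 * sqrt (real (m z) + 1)))"
  proof (rule sum_mono)
    fix z
    define M where "M = max (max (K' True z) (K' False z)) 0"
    have "M \<ge> 0" by (simp add: M_def)
    have "M \<le> real (m z) + 1"
      unfolding m_def M_def by linarith
    have "F z \<le> 12 * exp (2 * sqrt (6 * M))"
      unfolding F_def M_def by (rule test_fun_le) auto
    \<comment> \<open>After squaring this reads 24 * M \<le> 25 * (m z + 1).\<close>
    also have "2 * sqrt (6 * M) \<le> 5 * sqrt (real (m z) + 1)"
    proof (rule power2_le_imp_le)
      show "(2 * sqrt (6 * M))\<^sup>2 \<le> (5 * sqrt (real (m z) + 1))\<^sup>2"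
        using \<open>M \<le> _\<close> \<open>M \<ge> 0\<close> by (simp add: power_mult_distrib)
    qed simp
    finally show "F z \<le> 12 * exp (5 * sqrt (real (m z) + 1))" by simp
  qed
  also have "\<dots> = (\<Sum>j<J. \<Sum>z | z \<in> E \<and> m z = j. 12 * exp (5 * sqrt (real (m z) + 1)))"
  proof (rule sum.group[symmetric])
    show "m ` E \<subseteq> {..<J}"
      using finE by (auto simp: J_def less_Suc_eq_le)
  qed (use finE in auto)
  also have "\<dots> = (\<Sum>j<J. card {z \<in> E. m z = j} * (12 * exp (5 * sqrt (real j + 1))))"
    by (intro sum.cong refl) simp
  also have "\<dots> \<le> (\<Sum>j<J. 24 * exp (-6) * N * (1 / (real j + 1)\<^sup>2))"
  proof (rule sum_mono)
    fix j
    have "card {z \<in> E. m z = j} * (12 * exp (5 * sqrt (real j + 1)))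
       \<le> (2 * exp (-6 - 9 * sqrt (real j + 1)) * N) * (12 * exp (5 * sqrt (real j + 1)))"
      using card_level[of j] by (intro mult_right_mono) auto
    also have "\<dots> = 24 * N * (exp (-6 - 9 * sqrt (real j + 1)) * exp (5 * sqrt (real j + 1)))"
      by simp
    also have "exp (-6 - 9 * sqrt (real j + 1)) * exp (5 * sqrt (real j + 1))
        = exp (-6) * exp (- 4 * sqrt (real j + 1))"
      by (simp flip: exp_add)
    also have "24 * N * (exp (-6) * exp (- 4 * sqrt (real j + 1)))
        \<le> 24 * N * (exp (-6) * (1 / (real j + 1)\<^sup>2))"
      using exp_neg_sqrt_le[of "real j + 1"] Npos by (intro mult_left_mono) auto
    finally show "card {z \<in> E. m z = j} * (12 * exp (5 * sqrt (real j + 1)))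
        \<le> 24 * exp (-6) * N * (1 / (real j + 1)\<^sup>2)" by (simp add: mult_ac)
  qed
  also have "\<dots> = 24 * exp (-6) * N * (\<Sum>j<J. 1 / (real j + 1)\<^sup>2)"
    by (simp only: sum_distrib_left)
  also have "\<dots> \<le> 24 * exp (-6) * N * 2"
    using Npos by (intro mult_left_mono order.trans[OF sum_inverse_squares_le]) auto
  finally have inside: "sum F E \<le> 48 * exp (-6) * N" by simp

  \<comment> \<open>There are 48 units of \<open>exp (-6) * N\<close> from inside \<open>E\<close>
    and at most one from \<open>card E\<close>; since 49 < 64, the crude
    \<open>2 \<le> exp 1\<close> is enough.\<close>
  have "(2::real) ^ 6 \<le> exp 1 ^ 6"
    using exp_ge_add_one_self[of 1] by (intro power_mono) auto
  then have "(64::real) \<le> exp 6" by (simp flip: exp_of_nat_mult)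
  then have "exp (-6) \<le> (1/64 :: real)"
    by (simp add: exp_minus field_simps)
  moreover have "exp (-15) \<le> exp (-6 :: real)" by simp
  ultimately have "49 * exp (-6) * N < 1 * N" "exp (-15) * N \<le> exp (-6) * N"
    using Npos by (intro mult_strict_right_mono mult_right_mono; linarith)+
  then show False using nonneg out inside by linarith
qed

section \<open>From correlated kernels to a pivot vertex\<close>

lemma sum_centred_indicator_product:
  fixes p :: real
  assumes "finite Y" "A \<subseteq> Y" "B \<subseteq> Y" "card A = s" "card B = s" "p * card Y = s"
  shows "(\<Sum>w\<in>Y. (of_bool (w \<in> A) - p) * (of_bool (w \<in> B) - p)) = card (A \<inter> B) - p * s"
proof -
  have "(\<Sum>w\<in>Y. (of_bool (w \<in> A) - p) * (of_bool (w \<in> B) - p))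
      = (\<Sum>w\<in>Y. of_bool (w \<in> A \<inter> B) - p * of_bool (w \<in> A) - p * of_bool (w \<in> B) + p * p)"
    by (intro sum.cong refl) (auto simp: algebra_simps)
  also have "\<dots> = card (Y \<inter> (A \<inter> B)) - p * card (Y \<inter> A) - p * card (Y \<inter> B) + card Y * (p * p)"
    using assms(1) by (simp add: sum.distrib sum_subtractf Int_def flip: sum_distrib_left)
  also have "Y \<inter> (A \<inter> B) = A \<inter> B" using assms by auto
  also have "Y \<inter> A = A" using assms by auto
  also have "Y \<inter> B = B" using assms by auto
  also have "card Y * (p * p) = p * s"
    using assms(6) by (simp flip: assms(6))
  finally show ?thesis using assms by simp
qed

text \<open>Centred indicators of the neighbourhoods, scaled by
  \<open>sqrt (\<alpha> j * s j)\<close>, give Gram kernels in which a value \<open>c\<close> means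
  density \<open>p j + c * \<alpha> j\<close> of one neighbourhood inside the other. A correlated
  colour exists, and averaging over the first vertex of the pairs fixes \<open>x\<close>.\<close>

lemma exists_pivot:
  fixes N :: "bool \<Rightarrow> 'a \<Rightarrow> 'b set" and Y :: "bool \<Rightarrow> 'b set" and s :: "bool \<Rightarrow> nat"
    and \<alpha> :: "bool \<Rightarrow> real"
  assumes fin: "finite X" "\<And>j. finite (Y j)" and ne: "X \<noteq> {}"
    and deg: "\<And>j x. x \<in> X \<Longrightarrow> s j \<le> card (N j x \<inter> Y j)"
    and pos: "\<And>j. s j > 0" "\<And>j. \<alpha> j > 0"
  obtains x i \<mu> X' Z where "x \<in> X" "X' \<subseteq> X" "\<mu> \<ge> -1"
    "\<And>j. Z j \<subseteq> N j x \<inter> Y j" "\<And>j. card (Z j) = s j"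
    "exp (-15 - 9 * sqrt (\<mu> + 1)) * card X \<le> card X'"
    "\<And>y. y \<in> X' \<Longrightarrow> (s i / card (Y i) + \<mu> * \<alpha> i) * s i \<le> card (N i y \<inter> Z i)"
    "\<And>y. y \<in> X' \<Longrightarrow> (s (\<not> i) / card (Y (\<not> i)) - \<alpha> (\<not> i)) * s (\<not> i) \<le> card (N (\<not> i) y \<inter> Z (\<not> i))"
proof -
  \<comment> \<open>Trimming to exactly \<open>s j\<close> points gives all indicators the same mean
    \<open>p j\<close>, so that one constant centres them all.\<close>
  define N' where "N' j x = (SOME A. A \<subseteq> N j x \<inter> Y j \<and> card A = s j)" for j x
  have N': "N' j x \<subseteq> N j x \<inter> Y j" "card (N' j x) = s j" if "x \<in> X" for j x
  proof -
    have "\<exists>A. A \<subseteq> N j x \<inter> Y j \<and> card A = s j"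
      using obtain_subset_with_card_n[OF deg[OF that]] by metis
    from someI_ex[OF this] show "N' j x \<subseteq> N j x \<inter> Y j" "card (N' j x) = s j"
      unfolding N'_def by auto
  qed
  define p where "p j = real (s j) / card (Y j)" for j
  define \<phi> where "\<phi> j x w = (of_bool (w \<in> N' j x) - p j) / sqrt (\<alpha> j * s j)" for j x w
  define K where "K j x y = (\<Sum>w\<in>Y j. \<phi> j x w * \<phi> j y w)" for j x y
  have cardY: "card (Y j) > 0" for j
  proof -
    obtain x where "x \<in> X" using ne by blast
    then have "0 < card (N j x \<inter> Y j)" using deg[of x j] pos(1)[of j] by linarith
    then show ?thesis using fin(2)[of j] by (metis card_gt_0_iff Int_empty_right)
  qed
  have K_eq: "K j x y = (card (N' j x \<inter> N' j y) - p j * s j) / (\<alpha> j * s j)"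
    if "x \<in> X" "y \<in> X" for j x y
  proof -
    have "sqrt (\<alpha> j * s j) * sqrt (\<alpha> j * s j) = \<alpha> j * s j"
      using pos(2)[of j] by simp
    then have "K j x y = (\<Sum>w\<in>Y j. (of_bool (w \<in> N' j x) - p j) * (of_bool (w \<in> N' j y) - p j)) / (\<alpha> j * s j)"
      unfolding K_def \<phi>_def by (simp add: sum_divide_distrib)
    also have "\<dots> = (card (N' j x \<inter> N' j y) - p j * s j) / (\<alpha> j * s j)"
    proof -
      have "p j * card (Y j) = s j" using cardY[of j] by (simp add: p_def)
      then show ?thesis
        using sum_centred_indicator_product[of "Y j" "N' j x" "N' j y" "s j" "p j"]
          N'[OF that(1), of j] N'[OF that(2), of j] fin(2)[of j] by simp
    qed
    finally show ?thesis .
  qed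
  have K_ge: "(p j + c * \<alpha> j) * s j \<le> card (N j y \<inter> N' j x)" if "x \<in> X" "y \<in> X" "c \<le> K j x y" for j x y c
  proof -
    have "c * (\<alpha> j * s j) \<le> card (N' j x \<inter> N' j y) - p j * s j"
      using that(3) pos(1)[of j] pos(2)[of j] unfolding K_eq[OF that(1,2)] by (simp add: pos_le_divide_eq)
    moreover have "card (N' j x \<inter> N' j y) \<le> card (N j y \<inter> N' j x)"
      using N'(1)[OF that(1), of j] N'(1)[OF that(2), of j] fin(2)[of j]
      by (intro card_mono) (auto intro: finite_subset)
    ultimately show ?thesis by (simp add: algebra_simps)
  qed
  have gram: "gram_on X (Y j) (\<phi> j) (K j)" for j by (simp add: gram_on_def K_def)
  obtain i \<mu> where \<mu>: "\<mu> \<ge> -1"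
    "exp (-15 - 9 * sqrt (\<mu> + 1)) * (real (card X))\<^sup>2
      \<le> card {z \<in> X \<times> X. \<mu> \<le> K i (fst z) (snd z) \<and> -1 \<le> K (\<not> i) (fst z) (snd z)}"
    by (rule exists_correlated_colour[OF fin(1) ne gram])
  define A where "A x = {y \<in> X. \<mu> \<le> K i x y \<and> -1 \<le> K (\<not> i) x y}" for x
  have "{z \<in> X \<times> X. \<mu> \<le> K i (fst z) (snd z) \<and> -1 \<le> K (\<not> i) (fst z) (snd z)} = Sigma X A"
    by (auto simp: A_def)
  then have sum: "exp (-15 - 9 * sqrt (\<mu> + 1)) * (real (card X))\<^sup>2 \<le> (\<Sum>x\<in>X. real (card (A x)))"
    using \<mu>(2) fin(1) by (simp add: A_def)
  obtain x where x: "x \<in> X" "exp (-15 - 9 * sqrt (\<mu> + 1)) * card X \<le> card (A x)"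
  proof (rule ccontr)
    assume "\<not> thesis"
    then have "\<And>x. x \<in> X \<Longrightarrow> card (A x) < exp (-15 - 9 * sqrt (\<mu> + 1)) * card X"
      using that by (meson not_le)
    then have "(\<Sum>x\<in>X. real (card (A x))) < (\<Sum>x\<in>X. exp (-15 - 9 * sqrt (\<mu> + 1)) * card X)"
      using fin(1) ne by (intro sum_strict_mono) auto
    with sum show False by (simp add: power2_eq_square mult_ac)
  qed
  show thesis
  proof (rule that[of x "A x" \<mu> "\<lambda>j. N' j x" i])
    show "\<And>y. y \<in> A x \<Longrightarrow> (s i / card (Y i) + \<mu> * \<alpha> i) * s i \<le> card (N i y \<inter> N' i x)"
      using K_ge[OF x(1), of _ \<mu> i] by (auto simp: A_def p_def)
    show "\<And>y. y \<in> A x \<Longrightarrow> (s (\<not> i) / card (Y (\<not> i)) - \<alpha> (\<not> i)) * s (\<not> i) \<le> card (N (\<not> i) y \<inter> N' (\<not> i) x)"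
      using K_ge[OF x(1), of _ "-1" "\<not> i"] by (auto simp: A_def p_def)
    show "A x \<subseteq> X" by (auto simp: A_def)
  qed (rule x \<mu>(1) N'[OF x(1)])+
qed

section \<open>The book algorithm\<close>

definition mono_on_colour :: "('a \<Rightarrow> 'a \<Rightarrow> bool) \<Rightarrow> bool \<Rightarrow> 'a set \<Rightarrow> bool" where
  "mono_on_colour E i S \<longleftrightarrow> (\<forall>x\<in>S. \<forall>y\<in>S. x \<noteq> y \<longrightarrow> E x y = i)"

definition nbr :: "('a \<Rightarrow> 'a \<Rightarrow> bool) \<Rightarrow> bool \<Rightarrow> 'a \<Rightarrow> 'a set" where
  "nbr E i x = {y. y \<noteq> x \<and> E x y = i}"

lemma mono_on_colour_insert:
  assumes "symp E" "mono_on_colour E i S" "S \<subseteq> nbr E i x"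
  shows "mono_on_colour E i (insert x S)"
  using assms unfolding mono_on_colour_def nbr_def symp_def by blast

lemma mem_nbr_commute: "symp E \<Longrightarrow> x \<in> nbr E i y \<longleftrightarrow> y \<in> nbr E i x"
  by (auto simp: nbr_def symp_def)

section \<open>The state of the book process and its moves\<close>

text \<open>\<open>p0 i - \<delta>\<close> is a density floor and \<mu>0 separates clique steps from
  boosts. \<open>D\<close> is the price in \<open>ln (card X)\<close> per unit of progress; 16 is 15
  for the correlation plus 1 for deleting the pivot, and \<open>t * exp 2 / \<delta>\<close> is the
  largest boost that densities at most 1 permit. \<open>D'\<close> is the corresponding price for
  \<open>Y i\<close>, in units of \<open>L i\<close>. The bound on \<open>W\<close> reserves
  \<open>X\<close> for \<open>t\<close> clique steps and maximal progress in both colours.\<close>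

locale book_process =
  fixes E :: "'a \<Rightarrow> 'a \<Rightarrow> bool" and p0 :: "bool \<Rightarrow> real" and \<delta> \<mu>0 D D' :: real
    and t :: nat and W :: "'a set"
  assumes sym: "symp E" and \<delta>: "0 < \<delta>" "\<And>i. \<delta> < p0 i" "\<And>i. p0 i \<le> 1" and t: "2 \<le> t"
    and D: "0 \<le> D" "\<And>\<mu>. \<mu>0 \<le> \<mu> \<Longrightarrow> \<mu> \<le> t * exp 2 / \<delta> \<Longrightarrow> 16 + 9 * sqrt (\<mu> + 1) \<le> D * ln (1 + \<mu> / t)"
    and D': "0 \<le> \<mu>0" "0 \<le> D'" "1 \<le> D' * ln (1 + \<mu>0 / t)"
    and W: "finite W" "W \<noteq> {}" 
      "2 * t * (17 + 9 * sqrt (\<mu>0 + 1)) + 2 * D * (ln (1 / \<delta>) + 2) + 2 \<le> ln (card W)"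
begin

abbreviation "\<kappa> \<equiv> 17 + 9 * sqrt (\<mu>0 + 1)"
abbreviation "L i \<equiv> ln (1 / (p0 i - \<delta>))"

text \<open>Measured from the floor \<open>p0 i - \<delta>\<close>, a clique step is multiplicative:
  it costs at most the factor \<open>1 - 1 / t\<close>, so the floor is never reached.\<close>

definition excess :: "(bool \<Rightarrow> 'a set) \<Rightarrow> (bool \<Rightarrow> nat) \<Rightarrow> bool \<Rightarrow> real" where
  "excess Y s i = s i / card (Y i) - p0 i + \<delta>"

text \<open>\<open>\<delta>\<close> times the exponential of \<open>progress\<close> is the excess corrected for the factor \<open>1 - 1 / t\<close> lost at each
  vertex added to the clique. It never decreases, it grows by \<open>ln (1 + \<mu> / t)\<close> when the density
  is boosted with parameter \<open>\<mu>\<close>, and it is bounded since densities are at most 1. It therefore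
  pays for the boosts, both for the loss in \<open>X\<close> (rate \<open>D\<close>) and for the loss in \<open>Y i\<close> (rate \<open>D'\<close>).\<close>

definition progress :: "(bool \<Rightarrow> 'a set) \<Rightarrow> (bool \<Rightarrow> 'a set) \<Rightarrow> (bool \<Rightarrow> nat) \<Rightarrow> bool \<Rightarrow> real" where
  "progress Y T s i = ln (excess Y s i / \<delta>) + 2 * card (T i) / t"

text \<open>\<open>X\<close> is joined to both cliques in their colours, but \<open>Y i\<close> only
  to \<open>T i\<close>, so that \<open>T i\<close> and \<open>Y i\<close> form the book;
  \<open>s i\<close> is a lower bound on the degrees from \<open>X\<close> into \<open>Y i\<close>.
  Sizes are logarithmic because moves multiply: \<open>X\<close> pays \<kappa> per vertex and
  \<open>D\<close> per progress, \<open>Y i\<close> pays \<open>L i\<close> per vertex and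
  \<open>D' * L i\<close> per progress.\<close>

definition book_state :: "'a set \<Rightarrow> (bool \<Rightarrow> 'a set) \<Rightarrow> (bool \<Rightarrow> 'a set) \<Rightarrow> (bool \<Rightarrow> nat) \<Rightarrow> bool" where
  "book_state X Y T s \<longleftrightarrow>
     X \<subseteq> W \<and> X \<noteq> {} \<and>
     ln (card W) - (card (T True) + card (T False)) * \<kappa> - D * (progress Y T s True + progress Y T s False)
       \<le> ln (card X) \<and>
     (\<forall>i. Y i \<subseteq> W \<and> T i \<subseteq> W \<and> mono_on_colour E i (T i) \<and> (\<forall>x\<in>T i. X \<union> Y i \<subseteq> nbr E i x) \<and>
        card (T i) \<le> t \<and> 0 < s i \<and> (\<forall>x\<in>X. s i \<le> card (nbr E i x \<inter> Y i)) \<and>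
        0 < excess Y s i \<and> 0 \<le> progress Y T s i \<and>
        ln (card W) - (card (T i) + D' * progress Y T s i) * L i \<le> ln (card (Y i)))"

lemma L_nonneg: "0 \<le> L i"
  using \<delta>(1) \<delta>(2,3)[of i] by simp

text \<open>A vertex of \<open>X\<close> shows \<open>s i \<le> card (Y i)\<close>, so the excess is
  at most 1. The clique term of \<open>progress\<close> is at most 2, which explains
  \<open>exp (-2)\<close> below the excess and \<open>+ 2\<close> above the progress.\<close>

lemma book_state_facts:
  assumes "book_state X Y T s"
  shows "finite X" "finite (Y i)" "finite (T i)" "0 < card (Y i)" "s i \<le> card (Y i)"
    "excess Y s i \<le> 1" "\<delta> * exp (-2) \<le> excess Y s i" "progress Y T s i \<le> ln (1 / \<delta>) + 2"
    "p0 i - \<delta> < s i / card (Y i)"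
proof -
  show fin: "finite X" "finite (Y i)" "finite (T i)"
  proof -
    have "X \<subseteq> W" "Y i \<subseteq> W" "T i \<subseteq> W" using assms unfolding book_state_def by blast+
    then show "finite X" "finite (Y i)" "finite (T i)" using W(1) by (auto intro: finite_subset)
  qed
  obtain x where "x \<in> X" using assms unfolding book_state_def by blast
  moreover have "\<forall>x\<in>X. s i \<le> card (nbr E i x \<inter> Y i)" using assms unfolding book_state_def by blast
  ultimately have "s i \<le> card (nbr E i x \<inter> Y i)" by blast
  also have "\<dots> \<le> card (Y i)" using fin by (auto intro: card_mono)
  finally show le: "s i \<le> card (Y i)" .
  moreover have "0 < s i" using assms unfolding book_state_def by blast
  ultimately show pos: "0 < card (Y i)" by linarith
  have "s i / card (Y i) \<le> 1" using le pos by simp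
  then show ex: "excess Y s i \<le> 1" using \<delta>(2)[of i] by (simp add: excess_def)
  have ex0: "0 < excess Y s i" and pr: "0 \<le> progress Y T s i" and T: "card (T i) \<le> t"
    using assms unfolding book_state_def by blast+
  show "p0 i - \<delta> < s i / card (Y i)" using ex0 by (simp add: excess_def)
  have T': "2 * card (T i) / t \<le> 2" using T t by (simp add: divide_simps)
  have "ln (excess Y s i / \<delta>) \<le> ln (1 / \<delta>)"
    using ex ex0 \<delta>(1) by (simp add: divide_simps)
  then show "progress Y T s i \<le> ln (1 / \<delta>) + 2"
    using T' by (simp add: progress_def)
  have "-2 \<le> ln (excess Y s i / \<delta>)" using pr T' unfolding progress_def by linarith
  then have "exp (-2) \<le> excess Y s i / \<delta>"
    using ex0 \<delta>(1) by (metis divide_pos_pos exp_le_cancel_iff exp_ln)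
  then show "\<delta> * exp (-2) \<le> excess Y s i" using \<delta>(1) by (simp add: field_simps)
qed

text \<open>Treats both moves at once: a clique step has \<open>c = -1\<close>,
  \<open>d = 1\<close>, a boost has \<open>c = \<mu>\<close>, \<open>d = 0\<close>, and
  \<open>e\<close> is the guaranteed growth of progress. Replacing \<open>Y j\<close> by
  \<open>Z\<close> costs at most \<open>L j\<close>; the condition \<open>1 \<le> d + D' * e\<close>
  says that the new vertex or the progress covers this.\<close>

lemma book_state_update:
  fixes c :: real
  assumes inv: "book_state X Y T s"
    and X': "X' \<subseteq> X" "X' \<noteq> {}" and Z: "Z \<subseteq> Y j" "card Z = s j" and c: "-1 \<le> c"
    and deg: "\<And>y. y \<in> X' \<Longrightarrow> (s j / card (Y j) + c * (excess Y s j / t)) * s j \<le> card (nbr E j y \<inter> Z)"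
    and T': "T' \<subseteq> W" "mono_on_colour E j T'" "\<And>x. x \<in> T' \<Longrightarrow> X' \<union> Z \<subseteq> nbr E j x" 
      "card T' \<le> t"
    and d: "d = real (card T') - real (card (T j))" "e = ln (1 + c / t) + 2 * d / t"
    and e: "0 \<le> e" "1 \<le> d + D' * e"
    and lnX: "ln (card X) - d * \<kappa> - D * e \<le> ln (card X')"
  defines "s' \<equiv> nat \<lceil>(s j / card (Y j) + c * (excess Y s j / t)) * s j\<rceil>"
  shows "book_state X' (Y(j := Z)) (T(j := T')) (s(j := s'))"
proof -
  define g where "g = excess Y s j"
  define p where "p = s j / card (Y j)"
  have g: "0 < g" and sj: "0 < s j" and pr: "0 \<le> progress Y T s j"
    using inv unfolding book_state_def g_def by blast+
  note f = book_state_facts[OF inv]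
  have ct: "0 < 1 + c / t" using c t by (simp add: divide_simps)
  have p: "p = p0 j - \<delta> + g" by (simp add: p_def g_def excess_def)
  have pc: "p + c * (g / t) = p0 j - \<delta> + g * (1 + c / t)" by (simp add: p algebra_simps)
  have new_pos: "0 < p + c * (g / t)" using \<delta>(2)[of j] ct g unfolding pc by (simp add: add_pos_pos)
  have s': "(p + c * (g / t)) * s j \<le> s'" unfolding s'_def p_def g_def by linarith
  moreover have "0 < (p + c * (g / t)) * s j" using new_pos sj by simp
  ultimately have s'_pos: "0 < s'" by linarith
  have ex_new: "g * (1 + c / t) \<le> excess (Y(j := Z)) (s(j := s')) j"
  proof -
    have "p + c * (g / t) \<le> s' / s j" using s' sj by (simp add: pos_le_divide_eq)
    then show ?thesis unfolding pc by (simp add: excess_def Z(2))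
  qed
  have gct: "0 < g * (1 + c / t)" using g ct by simp
  have pr_new: "progress Y T s j + e \<le> progress (Y(j := Z)) (T(j := T')) (s(j := s')) j"
  proof -
    have "ln (g / \<delta>) + ln (1 + c / t) = ln (g * (1 + c / t) / \<delta>)"
      using g ct \<delta>(1) by (simp add: ln_mult ln_div)
    also have "\<dots> \<le> ln (excess (Y(j := Z)) (s(j := s')) j / \<delta>)"
      using ex_new gct \<delta>(1) by (intro ln_mono divide_right_mono divide_pos_pos) auto
    finally show ?thesis
      by (simp add: progress_def d g_def diff_divide_distrib)
  qed
  have other: "excess (Y(j := Z)) (s(j := s')) i = excess Y s i"
      "progress (Y(j := Z)) (T(j := T')) (s(j := s')) i = progress Y T s i" if "i \<noteq> j" for i
    using that by (auto simp: excess_def progress_def)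
  have X_old: "ln (card W) - (card (T True) + card (T False)) * \<kappa> - D * (progress Y T s True + progress Y T s False)
       \<le> ln (card X)" using inv unfolding book_state_def by blast
  have sum_T: "real (card ((T(j := T')) True) + card ((T(j := T')) False))
      = real (card (T True) + card (T False)) + d"
    by (cases j) (auto simp: d)
  have sum_pr: "progress Y T s True + progress Y T s False + e
     \<le> progress (Y(j := Z)) (T(j := T')) (s(j := s')) True + progress (Y(j := Z)) (T(j := T')) (s(j := s')) False"
    using pr_new other(2)[of "\<not> j"] by (cases j) simp_all
  have "ln (card W) - (card ((T(j := T')) True) + card ((T(j := T')) False)) * \<kappa>
      - D * (progress (Y(j := Z)) (T(j := T')) (s(j := s')) True + progress (Y(j := Z)) (T(j := T')) (s(j := s')) False)
      \<le> ln (card W) - (real (card (T True) + card (T False)) + d) * \<kappa>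
        - D * (progress Y T s True + progress Y T s False + e)"
    unfolding sum_T using mult_left_mono[OF sum_pr D(1)] by linarith
  also have "\<dots> \<le> ln (card X')" using X_old lnX by (simp add: algebra_simps)
  finally have X_new: "ln (card W) - (card ((T(j := T')) True) + card ((T(j := T')) False)) * \<kappa>
      - D * (progress (Y(j := Z)) (T(j := T')) (s(j := s')) True + progress (Y(j := Z)) (T(j := T')) (s(j := s')) False)
      \<le> ln (card X')" .
  have Y_new: "ln (card W) - (card T' + D' * progress (Y(j := Z)) (T(j := T')) (s(j := s')) j) * L j \<le> ln (card Z)"
  proof -
    have "ln (card W) - (card T' + D' * progress (Y(j := Z)) (T(j := T')) (s(j := s')) j) * L j
        \<le> ln (card W) - (card (T j) + d + D' * (progress Y T s j + e)) * L j"
      using mult_left_mono[OF pr_new D'(2)] L_nonneg[of j]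
      by (intro diff_left_mono mult_right_mono) (auto simp: d)
    also have "\<dots> \<le> ln (card W) - (card (T j) + D' * progress Y T s j + 1) * L j"
      using e(2) L_nonneg[of j] by (intro diff_left_mono mult_right_mono) (auto simp: algebra_simps)
    also have "\<dots> = ln (card W) - (card (T j) + D' * progress Y T s j) * L j - L j"
      by (simp add: algebra_simps)
    also have "\<dots> \<le> ln (card (Y j)) - L j" using inv unfolding book_state_def by simp
    also have "- L j = ln (p0 j - \<delta>)" using \<delta>(2)[of j] by (simp add: ln_div)
    then have "ln (card (Y j)) - L j = ln (card (Y j)) + ln (p0 j - \<delta>)" by simp
    also have "\<dots> \<le> ln (card (Y j)) + ln p"
      using g \<delta>(2)[of j] by (simp add: p)
    also have "\<dots> = ln (card (Y j) * p)"
      using f(4)[of j] sj by (subst ln_mult) (auto simp: p_def)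
    also have "card (Y j) * p = card Z" using f(4)[of j] by (simp add: p_def Z(2))
    finally show ?thesis .
  qed
  have deg': "s' \<le> card (nbr E j y \<inter> Z)" if "y \<in> X'" for y
    using deg[OF that] unfolding s'_def by (simp add: ceiling_le_iff nat_le_iff)
  have old: "Y i \<subseteq> W" "T i \<subseteq> W" "mono_on_colour E i (T i)" "card (T i) \<le> t" "0 < s i" for i
    using inv unfolding book_state_def by blast+
  show ?thesis
    unfolding book_state_def
  proof (intro conjI allI)
    fix i
    show "(Y(j := Z)) i \<subseteq> W" "(T(j := T')) i \<subseteq> W" "mono_on_colour E i ((T(j := T')) i)"
      "card ((T(j := T')) i) \<le> t" "0 < (s(j := s')) i"
      using old[of i] subset_trans[OF Z(1) old(1)] T'(1,2,4) s'_pos by (simp_all add: old)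
    show "\<forall>x\<in>(T(j := T')) i. X' \<union> (Y(j := Z)) i \<subseteq> nbr E i x"
    proof (cases "i = j")
      case True
      then show ?thesis using T'(3) by simp
    next
      case False
      have "\<forall>x\<in>T i. X \<union> Y i \<subseteq> nbr E i x" using inv unfolding book_state_def by blast
      with False X'(1) show ?thesis by (simp, blast)
    qed
    show "\<forall>x\<in>X'. (s(j := s')) i \<le> card (nbr E i x \<inter> (Y(j := Z)) i)"
    proof (cases "i = j")
      case True
      then show ?thesis using deg' by simp
    next
      case False
      have "\<forall>x\<in>X. s i \<le> card (nbr E i x \<inter> Y i)" using inv unfolding book_state_def by blast
      with False X'(1) show ?thesis by auto
    qed
    show "0 < excess (Y(j := Z)) (s(j := s')) i"
    proof (cases "i = j")
      case True
      then show ?thesis using less_le_trans[OF gct ex_new] by simp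
    next
      case False
      have "0 < excess Y s i" using inv unfolding book_state_def by blast
      with False other(1)[of i] show ?thesis by simp
    qed
    show "0 \<le> progress (Y(j := Z)) (T(j := T')) (s(j := s')) i"
    proof (cases "i = j")
      case True
      then show ?thesis using order_trans[OF add_nonneg_nonneg[OF pr e(1)] pr_new] by simp
    next
      case False
      have "0 \<le> progress Y T s i" using inv unfolding book_state_def by blast
      with False other(2)[of i] show ?thesis by simp
    qed
    show "ln (card W) - (card ((T(j := T')) i) + D' * progress (Y(j := Z)) (T(j := T')) (s(j := s')) i) * L i
        \<le> ln (card ((Y(j := Z)) i))"
    proof (cases "i = j")
      case True
      then show ?thesis using Y_new by simp
    next
      case False
      have "ln (card W) - (card (T i) + D' * progress Y T s i) * L i \<le> ln (card (Y i))"
        using inv unfolding book_state_def by blast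
      with False other(2)[of i] show ?thesis by simp
    qed
    show "X' \<subseteq> W" using inv X'(1) unfolding book_state_def by blast
    show "X' \<noteq> {}" by (rule X'(2))
  qed (rule X_new)
qed

text \<open>If \<mu> is at most \<mu>0, the loss in \<open>X\<close> is bounded by \<kappa> and the
  pivot joins a clique; otherwise the pivot is discarded and colour \<open>i\<close> is boosted, its
  progress paying for the larger loss. \<open>X\<close> shrinks strictly in both cases, which gives
  termination.\<close>

lemma book_state_pivot:
  assumes inv: "book_state X Y T s" and less: "\<And>i. card (T i) < t"
  obtains X' Y' T' s' where "X' \<subset> X" "book_state X' Y' T' s'"
proof -
  note f = book_state_facts[OF inv]
  have XW: "X \<subseteq> W" "X \<noteq> {}" using inv unfolding book_state_def by blast+
  have t0: "0 < real t" using t by simp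
  obtain x i \<mu> X0 Z where x: "x \<in> X" "X0 \<subseteq> X" and \<mu>: "-1 \<le> \<mu>"
    and Z: "\<And>j. Z j \<subseteq> nbr E j x \<inter> Y j" "\<And>j. card (Z j) = s j"
    and X0: "exp (-15 - 9 * sqrt (\<mu> + 1)) * card X \<le> card X0"
    and deg: "\<And>y. y \<in> X0 \<Longrightarrow> (s i / card (Y i) + \<mu> * (excess Y s i / t)) * s i \<le> card (nbr E i y \<inter> Z i)"
      "\<And>y. y \<in> X0 \<Longrightarrow> (s (\<not> i) / card (Y (\<not> i)) - excess Y s (\<not> i) / t) * s (\<not> i) \<le> card (nbr E (\<not> i) y \<inter> Z (\<not> i))"
  proof (rule exists_pivot[of X Y s "nbr E" "\<lambda>j. excess Y s j / t"])
    show "\<And>j x. x \<in> X \<Longrightarrow> s j \<le> card (nbr E j x \<inter> Y j)" "\<And>j. 0 < s j" "\<And>j. 0 < excess Y s j / t"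
      using inv t unfolding book_state_def by auto
    show "finite X" "\<And>j. finite (Y j)" "X \<noteq> {}" using f(1,2) XW by auto
  qed (rule that)
  have finX0: "finite X0" using x f(1) by (auto intro: finite_subset)
  have "0 < card X" using f(1) XW by (simp add: card_gt_0_iff)
  then have "0 < exp (-15 - 9 * sqrt (\<mu> + 1)) * card X" by simp
  with X0 have X0_pos: "0 < card X0" by linarith
  have lnX0: "ln (card X) - 15 - 9 * sqrt (\<mu> + 1) \<le> ln (card X0)"
    using \<open>0 < card X\<close> ln_mono[OF X0] by (simp add: ln_mult)
  have lnX: "ln (card W) - (card (T True) + card (T False)) * \<kappa> - D * (progress Y T s True + progress Y T s False)
      \<le> ln (card X)" using inv unfolding book_state_def by blast
  have \<kappa>: "0 \<le> \<kappa>" using D'(1) by simp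
  \<comment> \<open>Each colour still lacks a vertex, so \<open>2 * \<kappa>\<close> of the reserve
    is untouched; this keeps \<open>X0\<close> large enough to continue.\<close>
  have T_bound: "(card (T True) + card (T False)) * \<kappa> \<le> 2 * t * \<kappa> - 2 * \<kappa>"
  proof -
    have "real (card (T True) + card (T False)) \<le> 2 * real t - 2" using less[of True] less[of False] t by linarith
    from mult_right_mono[OF this \<kappa>] show ?thesis by (simp only: left_diff_distrib of_nat_mult of_nat_numeral)
  qed
  have pr_bound: "D * progress Y T s j \<le> D * (ln (1 / \<delta>) + 2)" for j
    by (intro mult_left_mono f D)
  have T_nbr: "x' \<in> T j \<Longrightarrow> X \<union> Y j \<subseteq> nbr E j x'" for j x'
    using inv unfolding book_state_def by blast
  have TW: "T j \<subseteq> W" "mono_on_colour E j (T j)" "card (T j) \<le> t" for j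
    using inv unfolding book_state_def by blast+
  have X_room: "2 * \<kappa> + 2 + 2 * D * (ln (1 / \<delta>) + 2) - D * (progress Y T s True + progress Y T s False)
      \<le> ln (card X)"
    using lnX T_bound W(3) by linarith
  have card_ge_2: "2 \<le> card X0" if "1 < ln (card X0)"
  proof -
    have "exp 1 < real (card X0)" using that X0_pos by (metis exp_ln exp_less_cancel_iff of_nat_0_less_iff)
    moreover have "2 \<le> exp (1::real)" using exp_ge_add_one_self[of 1] by simp
    ultimately show ?thesis by linarith
  qed
  show thesis
  proof (cases "\<mu> \<le> \<mu>0")
    case True
    have sq: "sqrt (\<mu> + 1) \<le> sqrt (\<mu>0 + 1)" using True by simp
    have lnX0': "ln (card X) - 15 - 9 * sqrt (\<mu>0 + 1) \<le> ln (card X0)" using lnX0 sq by linarith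
    have "1 < ln (card X0)"
    proof -
      have "2 * \<kappa> + 2 \<le> ln (card X)"
      proof -
        have "D * (progress Y T s True + progress Y T s False) = D * progress Y T s True + D * progress Y T s False"
          "2 * D * (ln (1 / \<delta>) + 2) = D * (ln (1 / \<delta>) + 2) + D * (ln (1 / \<delta>) + 2)"
          by (simp_all add: algebra_simps)
        then show ?thesis using X_room pr_bound[of True] pr_bound[of False] by linarith
      qed
      then show ?thesis using lnX0' \<kappa> by argo
    qed
    then have c2: "2 \<le> card X0" by (rule card_ge_2)
    have "X0 \<subseteq> insert x ((nbr E True x \<inter> X0) \<union> (nbr E False x \<inter> X0))"
      by (auto simp: nbr_def)
    then have "card X0 \<le> card (insert x ((nbr E True x \<inter> X0) \<union> (nbr E False x \<inter> X0)))"
      using finX0 by (intro card_mono) auto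
    also have "\<dots> \<le> 1 + card ((nbr E True x \<inter> X0) \<union> (nbr E False x \<inter> X0))"
      using finX0 by (simp add: card_insert_if)
    also have "\<dots> \<le> 1 + card (nbr E True x \<inter> X0) + card (nbr E False x \<inter> X0)"
      using card_Un_le by simp
    finally have "card X0 \<le> 1 + 2 * card (nbr E True x \<inter> X0) \<or> card X0 \<le> 1 + 2 * card (nbr E False x \<inter> X0)"
      by linarith
    \<comment> \<open>The majority colour \<open>j\<close> may differ from the favoured colour
      \<open>i\<close>. The factor 4 in the next line absorbs the pivot itself; its logarithm is the
      2 in 17 = 15 + 2.\<close>
    then obtain j where "card X0 \<le> 1 + 2 * card (nbr E j x \<inter> X0)" by blast
    then have j: "card X0 \<le> 4 * card (nbr E j x \<inter> X0)" using c2 by linarith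
    define X1 where "X1 = nbr E j x \<inter> X0"
    have X1_pos: "0 < card X1" using j c2 unfolding X1_def by linarith
    have "ln (card X0) \<le> ln (4 * card X1)"
      using j X0_pos unfolding X1_def by (subst ln_le_cancel_iff) linarith+
    also have "\<dots> = ln 4 + ln (card X1)" using X1_pos by (simp add: ln_mult)
    also have "ln (4::real) \<le> 2"
      using ln_mult[of 2 2] ln_le_minus_one[of 2] by simp
    finally have lnX1: "ln (card X0) - 2 \<le> ln (card X1)" by simp
    have x_notin: "x \<notin> T j" using T_nbr[of x j] x by (auto simp: nbr_def)
    have card_T: "card (insert x (T j)) = Suc (card (T j))" using x_notin f(3) by simp
    \<comment> \<open>This is why \<open>progress\<close> contains
      \<open>2 * card (T i) / t\<close>: a new vertex adds \<open>2 / t\<close>, which outweighs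
      \<open>ln (1 - 1 / t)\<close> for \<open>t \<ge> 2\<close>.\<close>
    have ln_t: "0 \<le> ln (1 + (-1) / t) + 2 * 1 / t"
    proof -
      have "2 * (1 / real t) * (1 / real t) \<le> 1 * (1 / real t)"
        using t by (intro mult_right_mono) (auto simp: divide_simps)
      then have "- (2 / real t) \<le> - (1 / t) - 2 * (1 / real t)\<^sup>2"
        by (simp add: power2_eq_square)
      also have "\<dots> \<le> ln (1 - 1 / t)"
        using t by (intro ln_one_minus_pos_lower_bound) (auto simp: divide_simps)
      finally show ?thesis by simp
    qed
    show thesis
    proof (rule that[OF _ book_state_update[OF inv, where X' = X1 and Z = "Z j" and j = j and c = "-1"
            and T' = "insert x (T j)" and d = 1 and e = "ln (1 + (-1) / t) + 2 * 1 / t"]])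
      show "X1 \<subset> X" using x by (auto simp: X1_def nbr_def)
      show "X1 \<subseteq> X" using x by (auto simp: X1_def)
      show "X1 \<noteq> {}" using X1_pos by (metis card.empty less_irrefl)
      show "Z j \<subseteq> Y j" "card (Z j) = s j" using Z by auto
      show "insert x (T j) \<subseteq> W" using x XW TW by auto
      show "mono_on_colour E j (insert x (T j))"
      proof (rule mono_on_colour_insert[OF sym TW(2)])
        show "T j \<subseteq> nbr E j x" using T_nbr[of _ j] x(1) mem_nbr_commute[OF sym] by blast
      qed
      show "X1 \<union> Z j \<subseteq> nbr E j x'" if "x' \<in> insert x (T j)" for x'
        using that T_nbr[of x' j] Z(1)[of j] x(2) unfolding X1_def by blast
      show "card (insert x (T j)) \<le> t" using less[of j] by (simp add: card_T)
      show "1 = real (card (insert x (T j))) - real (card (T j))" by (simp add: card_T)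
      show "0 \<le> ln (1 + (-1) / t) + 2 * 1 / t" by (rule ln_t)
      show "1 \<le> 1 + D' * (ln (1 + (-1) / t) + 2 * 1 / t)" using ln_t D'(2) by simp
      show "ln (card X) - 1 * \<kappa> - D * (ln (1 + (-1) / t) + 2 * 1 / t) \<le> ln (card X1)"
        using lnX1 lnX0' mult_nonneg_nonneg[OF D(1) ln_t] unfolding mult_1_left by linarith
      \<comment> \<open>As \<open>-1 \<le> \<mu>\<close>, the guarantee with \<open>-1\<close> holds
        in both colours, whichever is the majority.\<close>
      show "(s j / card (Y j) + (-1) * (excess Y s j / t)) * s j \<le> card (nbr E j y \<inter> Z j)" if "y \<in> X1" for y
      proof (cases "j = i")
        case True
        have y: "y \<in> X0" using that by (simp add: X1_def)
        have "0 \<le> excess Y s j / t" using inv t0 unfolding book_state_def by (simp add: less_imp_le)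
        then have le: "(-1) * (excess Y s j / t) \<le> \<mu> * (excess Y s j / t)" by (intro mult_right_mono \<mu>)
        have "(s j / card (Y j) + (-1) * (excess Y s j / t)) * s j
            \<le> (s j / card (Y j) + \<mu> * (excess Y s j / t)) * s j"
          by (rule mult_right_mono[OF add_left_mono[OF le]]) simp
        also have "\<dots> \<le> card (nbr E j y \<inter> Z j)" using deg(1)[OF y] True by simp
        finally show ?thesis .
      next
        case False
        then have "j = (\<not> i)" by auto
        then show ?thesis using deg(2)[of y] that by (simp add: X1_def)
      qed
    qed auto
  next
    case False
    obtain y where y: "y \<in> X0" using X0_pos by fastforce
    have si: "0 < s i" and ex: "0 < excess Y s i" and pr: "0 \<le> progress Y T s i" using inv unfolding book_state_def by blast+
    have finZ: "finite (Z i)" using Z(1)[of i] f(2)[of i] by (auto intro: finite_subset)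
    have "card (nbr E i y \<inter> Z i) \<le> card (Z i)" using finZ by (intro card_mono) auto
    then have "(s i / card (Y i) + \<mu> * (excess Y s i / t)) * s i \<le> 1 * real (s i)"
      using deg(1)[OF y] Z(2)[of i] by linarith
    then have le1: "s i / card (Y i) + \<mu> * (excess Y s i / t) \<le> 1"
      by (rule mult_right_le_imp_le) (use si in simp)
    have \<mu>_pos: "0 \<le> \<mu>" using False D'(1) by linarith
    \<comment> \<open>Even the boosted density is at most 1, while the excess is at least
      \<open>\<delta> * exp (-2)\<close>; so \<mu> lies in the range covered by
      \<open>D\<close>.\<close>
    have \<mu>_le: "\<mu> \<le> t * exp 2 / \<delta>"
    proof -
      have "\<mu> * (excess Y s i / t) \<le> 1" using le1 by (smt (verit) divide_nonneg_nonneg of_nat_0_le_iff)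
      moreover have "\<mu> * ((\<delta> * exp (-2)) / t) \<le> \<mu> * (excess Y s i / t)"
        using f(7)[of i] \<mu>_pos t0 by (intro mult_left_mono divide_right_mono) auto
      ultimately have "\<mu> * ((\<delta> * exp (-2)) / t) \<le> 1" by linarith
      then show ?thesis using t0 \<delta>(1) by (simp add: exp_minus field_simps)
    qed
    have D\<mu>: "16 + 9 * sqrt (\<mu> + 1) \<le> D * ln (1 + \<mu> / t)"
      using False \<mu>_le by (intro D) auto
    have ln_nonneg: "0 \<le> ln (1 + \<mu> / t)" using \<mu>_pos t0 by simp
    \<comment> \<open>Progress is bounded after the boost, so the reserve in \<open>W\<close>
      already contains the payment for this boost.\<close>
    have pr_new: "progress Y T s i + ln (1 + \<mu> / t) \<le> ln (1 / \<delta>) + 2"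
    proof -
      have "excess Y s i * (1 + \<mu> / t) = excess Y s i + \<mu> * (excess Y s i / t)"
        by (simp add: distrib_left distrib_right mult.commute)
      also have "\<dots> = s i / card (Y i) + \<mu> * (excess Y s i / t) - p0 i + \<delta>"
        by (simp add: excess_def)
      also have "\<dots> \<le> 1" using le1 \<delta>(2)[of i] by linarith
      finally have "ln (excess Y s i * (1 + \<mu> / t) / \<delta>) \<le> ln (1 / \<delta>)"
        using ex \<mu>_pos t0 \<delta>(1) by (intro ln_mono divide_right_mono divide_pos_pos mult_pos_pos) (auto simp: add_pos_nonneg)
      moreover have "ln (excess Y s i * (1 + \<mu> / t) / \<delta>) = ln (excess Y s i / \<delta>) + ln (1 + \<mu> / t)"
      proof -
        have "0 < 1 + \<mu> / t" using \<mu>_pos t0 by (simp add: add_pos_nonneg)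
        then show ?thesis using ex \<delta>(1) by (simp add: ln_mult ln_div)
      qed
      moreover have "2 * card (T i) / t \<le> 2" using less[of i] t0 by (simp add: divide_simps)
      ultimately show ?thesis unfolding progress_def by linarith
    qed
    have "D * (progress Y T s True + progress Y T s False) + D * ln (1 + \<mu> / t) \<le> 2 * D * (ln (1 / \<delta>) + 2)"
    proof -
      have "progress Y T s True + progress Y T s False + ln (1 + \<mu> / t) \<le> 2 * (ln (1 / \<delta>) + 2)"
        using pr_new f(8)[of "\<not> i"] by (cases i) auto
      from mult_left_mono[OF this D(1)] show ?thesis by (simp add: algebra_simps)
    qed
    then have lnX0_2: "2 * \<kappa> + 2 + D * ln (1 + \<mu> / t) \<le> ln (card X)" using X_room by linarith
    then have "1 < ln (card X0)" using lnX0 D\<mu> \<kappa> by argo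
    then have c2: "2 \<le> card X0" by (rule card_ge_2)
    \<comment> \<open>Deleting the pivot makes \<open>X\<close> strictly smaller although no clique
      grows; it costs at most 1 in the logarithm.\<close>
    define X1 where "X1 = X0 - {x}"
    have j: "card X0 \<le> 2 * card X1"
      using c2 finX0 by (auto simp: X1_def card_Diff_singleton_if)
    have X1_pos: "0 < card X1" using j c2 by linarith
    have "ln (card X0) \<le> ln (2 * card X1)"
      using j X0_pos by (subst ln_le_cancel_iff) linarith+
    also have "\<dots> = ln 2 + ln (card X1)" using X1_pos by (simp add: ln_mult)
    also have "ln (2::real) \<le> 1" using ln_le_minus_one[of 2] by simp
    finally have lnX1: "ln (card X0) - 1 \<le> ln (card X1)" by simp
    have mono: "1 \<le> D' * ln (1 + \<mu> / t)"
    proof -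
      have "ln (1 + \<mu>0 / t) \<le> ln (1 + \<mu> / t)"
        using False D'(1) t0 by (intro ln_mono add_left_mono divide_right_mono) (auto simp: add_pos_nonneg)
      from mult_left_mono[OF this D'(2)] show ?thesis using D'(3) by linarith
    qed
    show thesis
    proof (rule that[OF _ book_state_update[OF inv, where X' = X1 and Z = "Z i" and j = i and c = \<mu>
            and T' = "T i" and d = 0 and e = "ln (1 + \<mu> / t)"]])
      show "X1 \<subset> X" using x by (auto simp: X1_def)
      show "X1 \<subseteq> X" using x by (auto simp: X1_def)
      show "X1 \<noteq> {}" using X1_pos by (metis card.empty less_irrefl)
      show "Z i \<subseteq> Y i" "card (Z i) = s i" using Z by auto
      show "X1 \<union> Z i \<subseteq> nbr E i x'" if "x' \<in> T i" for x'
        using that T_nbr[of x' i] Z(1)[of i] x(2) unfolding X1_def by blast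
      show "ln (card X) - 0 * \<kappa> - D * (ln (1 + \<mu> / t)) \<le> ln (card X1)"
        using lnX1 lnX0 D\<mu> unfolding mult_zero_left by linarith
      show "(s i / card (Y i) + \<mu> * (excess Y s i / t)) * s i \<le> card (nbr E i y \<inter> Z i)" if "y \<in> X1" for y
        using deg(1)[of y] that by (simp add: X1_def)
    qed (use \<mu> TW ln_nonneg mono in auto)
  qed
qed

text \<open>The invariant keeps \<open>X\<close> nonempty, so its shrinking can stop only when some
  \<open>T i\<close> has reached size \<open>t\<close>.\<close>

lemma book_state_imp_book:
  assumes "book_state X Y T s"
  shows "\<exists>i A B. A \<subseteq> W \<and> B \<subseteq> W \<and> mono_on_colour E i A \<and> card A = t \<and> (\<forall>x\<in>A. B \<subseteq> nbr E i x) \<and> 0 < card B \<and>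
      ln (card W) - (t + D' * (ln (1 / \<delta>) + 2)) * L i \<le> ln (card B)"
  using assms
proof (induction "card X" arbitrary: X Y T s rule: less_induct)
  case less
  note inv = less.prems and f = book_state_facts[OF less.prems]
  show ?case
  proof (cases "\<exists>i. card (T i) = t")
    case True
    then obtain i where i: "card (T i) = t" by blast
    have "(t + D' * progress Y T s i) * L i \<le> (t + D' * (ln (1 / \<delta>) + 2)) * L i"
      using f(8)[of i] D'(2) by (intro mult_right_mono add_left_mono mult_left_mono L_nonneg) auto
    moreover have "ln (card W) - (card (T i) + D' * progress Y T s i) * L i \<le> ln (card (Y i))"
      using inv unfolding book_state_def by blast
    ultimately have "ln (card W) - (t + D' * (ln (1 / \<delta>) + 2)) * L i \<le> ln (card (Y i))"
      using i by simp
    moreover have "T i \<subseteq> W" "Y i \<subseteq> W" "mono_on_colour E i (T i)" "\<forall>x\<in>T i. Y i \<subseteq> nbr E i x"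
      using inv unfolding book_state_def by blast+
    ultimately show ?thesis
      using i f(4)[of i] by (intro exI[of _ i] exI[of _ "T i"] exI[of _ "Y i"]) simp
  next
    case False
    have "card (T i) \<le> t" for i using inv unfolding book_state_def by blast
    with False have "card (T i) < t" for i by (metis le_neq_implies_less)
    then obtain X' Y' T' s' where X': "X' \<subset> X" "book_state X' Y' T' s'" by (rule book_state_pivot[OF inv])
    then have "card X' < card X" using f(1) by (simp add: psubset_card_mono)
    then show ?thesis by (rule less.hyps[OF _ X'(2)])
  qed
qed

text \<open>The process starts from \<open>X = Y True = Y False = W\<close> with empty cliques; the
  degree hypothesis makes the initial excess at least \<delta> and hence the progress
  nonnegative.\<close>

lemma exists_book:
  assumes deg: "\<forall>i. \<forall>x\<in>W. p0 i * card W \<le> card (nbr E i x \<inter> W)"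
  shows "\<exists>i A B. A \<subseteq> W \<and> B \<subseteq> W \<and> mono_on_colour E i A \<and> card A = t \<and> (\<forall>x\<in>A. B \<subseteq> nbr E i x) \<and> 0 < card B \<and>
      ln (card W) - (t + D' * (ln (1 / \<delta>) + 2)) * L i \<le> ln (card B)"
proof -
  define s where "s i = nat \<lceil>p0 i * card W\<rceil>" for i
  have cW: "0 < card W" using W by (simp add: card_gt_0_iff)
  have p0: "0 < p0 i" for i using \<delta>(1) \<delta>(2)[of i] by linarith
  have s_ge: "p0 i * card W \<le> s i" for i unfolding s_def by linarith
  have s_pos: "0 < s i" for i
  proof -
    have "0 < p0 i * card W" using cW p0 by simp
    then show ?thesis using s_ge[of i] by linarith
  qed
  have s_le: "s i \<le> card (nbr E i x \<inter> W)" if "x \<in> W" for i x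
    using bspec[OF spec[OF deg, of i] that] unfolding s_def by (simp add: ceiling_le_iff nat_le_iff)
  have ex: "\<delta> \<le> excess (\<lambda>_. W) s i" for i
    using s_ge[of i] cW by (simp add: excess_def pos_le_divide_eq)
  have pr: "0 \<le> progress (\<lambda>_. W) (\<lambda>_. {}) s i" for i
    using ex[of i] \<delta>(1) by (simp add: progress_def)
  have "book_state W (\<lambda>_. W) (\<lambda>_. {}) s"
    unfolding book_state_def
  proof (intro conjI allI)
    show "ln (card W) - (card {} + card {}) * \<kappa>
       - D * (progress (\<lambda>_. W) (\<lambda>_. {}) s True + progress (\<lambda>_. W) (\<lambda>_. {}) s False) \<le> ln (card W)"
      using pr D(1) by simp
    show "ln (card W) - (card {} + D' * progress (\<lambda>_. W) (\<lambda>_. {}) s i) * L i \<le> ln (card W)" for i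
      using mult_nonneg_nonneg[OF mult_nonneg_nonneg[OF D'(2) pr[of i]] L_nonneg[of i]] by simp
    show "0 < excess (\<lambda>_. W) s i" for i using ex[of i] \<delta>(1) by linarith
  qed (use W pr s_pos s_le in \<open>auto simp: mono_on_colour_def\<close>)
  then show ?thesis by (rule book_state_imp_book)
qed

end

section \<open>Cliques, degree regularisation and binomial coefficients\<close>

definition has_mono :: "('a \<Rightarrow> 'a \<Rightarrow> bool) \<Rightarrow> 'a set \<Rightarrow> bool \<Rightarrow> nat \<Rightarrow> bool" where
  "has_mono E V i u \<longleftrightarrow> (\<exists>S\<subseteq>V. finite S \<and> card S = u \<and> mono_on_colour E i S)"

lemma has_mono_subset: "W \<subseteq> V \<Longrightarrow> has_mono E W i u \<Longrightarrow> has_mono E V i u"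
  unfolding has_mono_def by blast

lemma has_mono_book:
  assumes "symp E" "A \<subseteq> V" "B \<subseteq> V" "finite A" "mono_on_colour E i A"
    and AB: "\<And>x. x \<in> A \<Longrightarrow> B \<subseteq> nbr E i x" and "has_mono E B i u"
  shows "has_mono E V i (u + card A)"
proof -
  obtain S where S: "S \<subseteq> B" "finite S" "card S = u" "mono_on_colour E i S"
    using assms(7) unfolding has_mono_def by blast
  have "mono_on_colour E i (S \<union> A)"
    unfolding mono_on_colour_def
  proof (intro ballI impI)
    fix x y assume xy: "x \<in> S \<union> A" "y \<in> S \<union> A" "x \<noteq> y"
    have cross: "E v w = i" "E w v = i" if "v \<in> A" "w \<in> S" for v w
      using AB[OF that(1)] that(2) S(1) assms(1) by (auto simp: nbr_def symp_def)
    from xy show "E x y = i"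
      using S(4) assms(5) cross unfolding mono_on_colour_def by (elim UnE) simp_all
  qed
  moreover have "S \<inter> A = {}"
    using AB S(1) by (fastforce simp: nbr_def)
  then have "card (S \<union> A) = u + card A"
    using S assms(4) by (simp add: card_Un_disjoint)
  ultimately show ?thesis
    unfolding has_mono_def using S assms(2-4) by (intro exI[of _ "S \<union> A"]) auto
qed

lemma has_mono_nbr:
  assumes "symp E" "x \<in> V" "has_mono E (nbr E i x \<inter> V) i u"
  shows "has_mono E V i (Suc u)"
  using has_mono_book[of E "{x}" V "nbr E i x \<inter> V" i u] assms
  by (simp add: mono_on_colour_def)

lemma card_nbr_split:
  assumes "finite V" "x \<in> V"
  shows "card V = 1 + card (nbr E i x \<inter> V) + card (nbr E (\<not> i) x \<inter> V)"
proof -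
  have "V = insert x ((nbr E i x \<inter> V) \<union> (nbr E (\<not> i) x \<inter> V))"
    using assms(2) by (auto simp: nbr_def)
  moreover have "x \<notin> (nbr E i x \<inter> V) \<union> (nbr E (\<not> i) x \<inter> V)" by (auto simp: nbr_def)
  ultimately have "card V = Suc (card ((nbr E i x \<inter> V) \<union> (nbr E (\<not> i) x \<inter> V)))"
    using assms(1) by (metis card_insert_disjoint finite_Int finite_Un)
  also have "card ((nbr E i x \<inter> V) \<union> (nbr E (\<not> i) x \<inter> V)) = card (nbr E i x \<inter> V) + card (nbr E (\<not> i) x \<inter> V)"
    using assms(1) by (intro card_Un_disjoint) (auto simp: nbr_def)
  finally show ?thesis by simp
qed

text \<open>Induction by Pascal's rule. The vertex \<open>x\<close> makes the pigeonhole exact: if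
  both neighbourhoods fell short by at least one, then even together with \<open>x\<close> they
  would miss the sum of the two coefficients.\<close>

lemma erdos_szekeres:
  assumes "symp E" "finite V" "(k + l) choose k \<le> card V"
  shows "has_mono E V True (k + 1) \<or> has_mono E V False (l + 1)"
  using assms(2,3)
proof (induction "k + l" arbitrary: k l V)
  case 0
  then obtain x where "x \<in> V" by fastforce
  then have "has_mono E V True 1"
    unfolding has_mono_def by (intro exI[of _ "{x}"]) (auto simp: mono_on_colour_def)
  then show ?case using 0 by simp
next
  case (Suc n)
  obtain x where x: "x \<in> V"
  proof -
    have "0 < (k + l) choose k" by simp
    then show thesis using that Suc.prems by fastforce
  qed
  have single: "has_mono E V i 1" for i
    unfolding has_mono_def using x by (intro exI[of _ "{x}"]) (auto simp: mono_on_colour_def)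
  show ?case
  proof (cases "k = 0 \<or> l = 0")
    case True
    then show ?thesis using single by auto
  next
    case False
    then obtain k' l' where kl: "k = Suc k'" "l = Suc l'" by (metis not0_implies_Suc)
    have "(k + l) choose k = ((k' + l) choose k') + ((k + l') choose k)"
      by (simp add: kl)
    then have "(k' + l) choose k' \<le> card (nbr E True x \<inter> V) \<or> (k + l') choose k \<le> card (nbr E False x \<inter> V)"
      using card_nbr_split[OF Suc.prems(1) x, of E True] Suc.prems(2) by auto
    then show ?thesis
    proof
      assume "(k' + l) choose k' \<le> card (nbr E True x \<inter> V)"
      then have "has_mono E (nbr E True x \<inter> V) True (k' + 1) \<or> has_mono E (nbr E True x \<inter> V) False (l + 1)"
        using Suc.hyps(1)[of k' l "nbr E True x \<inter> V"] Suc.hyps(2) Suc.prems(1) kl by simp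
      then show ?thesis
        using has_mono_nbr[OF assms(1) x, of True "k' + 1"] has_mono_subset[OF Int_lower2, of E "nbr E True x" V False "l + 1"]
        by (auto simp: kl)
    next
      assume "(k + l') choose k \<le> card (nbr E False x \<inter> V)"
      then have "has_mono E (nbr E False x \<inter> V) True (k + 1) \<or> has_mono E (nbr E False x \<inter> V) False (l' + 1)"
        using Suc.hyps(1)[of k l' "nbr E False x \<inter> V"] Suc.hyps(2) Suc.prems(1) kl by simp
      then show ?thesis
        using has_mono_nbr[OF assms(1) x, of False "l' + 1"] has_mono_subset[OF Int_lower2, of E "nbr E False x" V True "k + 1"]
        by (auto simp: kl)
    qed
  qed
qed

text \<open>Induction on the step budget \<open>m\<close>, with \<open>a i\<close> counting the
  vertices set aside in colour \<open>i\<close>. The alternative separates an exhausted budget from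
  an early stop; a set without vertices of high degree is kept for every larger budget.\<close>

lemma regularise:
  fixes g :: "bool \<Rightarrow> real"
  assumes "symp E" "\<And>i. 0 \<le> g i"
  shows "\<exists>a W. W \<subseteq> V \<and> (\<forall>i u. has_mono E W i u \<longrightarrow> has_mono E V i (u + a i)) \<and>
    g True ^ a True * g False ^ a False * card V \<le> card W \<and>
    (a True + a False = m \<or>
      a True + a False < m \<and> (\<forall>i. \<forall>x\<in>W. card (nbr E i x \<inter> W) < g i * card W))"
proof (induction m)
  case 0
  show ?case by (intro exI[of _ "\<lambda>_. 0"] exI[of _ V]) simp
next
  case (Suc m)
  then obtain a W where W: "W \<subseteq> V" "\<And>i u. has_mono E W i u \<Longrightarrow> has_mono E V i (u + a i)"
    "g True ^ a True * g False ^ a False * card V \<le> card W"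
    and alt: "a True + a False = m \<or>
      a True + a False < m \<and> (\<forall>i. \<forall>x\<in>W. card (nbr E i x \<inter> W) < g i * card W)"
    by blast
  show ?case
  proof (cases "\<forall>i. \<forall>x\<in>W. card (nbr E i x \<inter> W) < g i * card W")
    case True
    then show ?thesis using W alt by (intro exI[of _ a] exI[of _ W]) auto
  next
    case False
    then obtain i x where x: "x \<in> W" "g i * card W \<le> card (nbr E i x \<inter> W)"
      by (meson not_le)
    have sum: "a True + a False = m" using alt False by blast
    define a' where "a' = a(i := Suc (a i))"
    have "g True ^ a' True * g False ^ a' False * card V = g i * (g True ^ a True * g False ^ a False * card V)"
      by (cases i) (simp_all add: a'_def)
    also have "\<dots> \<le> g i * card W" by (rule mult_left_mono[OF W(3) assms(2)])
    also note x(2)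
    finally have "g True ^ a' True * g False ^ a' False * card V \<le> card (nbr E i x \<inter> W)" .
    moreover have "has_mono E V j (u + a' j)" if "has_mono E (nbr E i x \<inter> W) j u" for j u
    proof (cases "j = i")
      case True
      then have "has_mono E W i (Suc u)" using has_mono_nbr[OF assms(1) x(1)] that by simp
      from W(2)[OF this] True show ?thesis by (simp add: a'_def)
    next
      case False
      then show ?thesis using W(2)[OF has_mono_subset[OF _ that]] by (simp add: a'_def)
    qed
    moreover have "a' True + a' False = Suc m" using sum by (cases i) (simp_all add: a'_def)
    ultimately show ?thesis
      using W(1) by (intro exI[of _ a'] exI[of _ "nbr E i x \<inter> W"]) auto
  qed
qed

section \<open>Binomial coefficients along a descent\<close>

text \<open>Indexing by the two clique sizes makes the symmetry of the colours a plain swap of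
  arguments.\<close>

definition binom2 :: "nat \<Rightarrow> nat \<Rightarrow> real" where
  "binom2 k l = real ((k + l) choose k)"

lemma binom2_pos: "0 < binom2 k l" by (simp add: binom2_def)

lemma binom2_commute: "binom2 k l = binom2 l k"
  using binomial_symmetric[of k "k + l"] by (simp add: binom2_def add.commute)

lemma binom2_Suc: "binom2 k l = binom2 (Suc k) l * (Suc k / (Suc k + l))"
proof -
  have "Suc (k + l) * ((k + l) choose k) = (Suc (k + l) choose Suc k) * Suc k"
    by (rule Suc_times_binomial_eq)
  then have "real (Suc (k + l) * ((k + l) choose k)) = real ((Suc (k + l) choose Suc k) * Suc k)"
    by (simp only:)
  then have "real (Suc (k + l)) * binom2 k l = binom2 (Suc k) l * Suc k"
    by (simp only: binom2_def of_nat_mult add_Suc)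
  then show ?thesis by (simp add: field_simps)
qed

lemma binom2_diff_le:
  assumes "a \<le> k" "real k \<le> K" "0 < M" "M \<le> real (k - a) + real l"
  shows "binom2 (k - a) l \<le> binom2 k l * (K / M) ^ a"
  using assms(1,4)
proof (induction a)
  case (Suc a)
  have ka: "k - a = Suc (k - Suc a)" using Suc.prems by simp
  have IH: "binom2 (k - a) l \<le> binom2 k l * (K / M) ^ a"
    using Suc.prems by (intro Suc.IH) auto
  have "real (k - a) / (real (k - a) + l) \<le> K / M"
    using Suc.prems assms(2,3) by (intro frac_le) auto
  have "binom2 (k - Suc a) l = binom2 (k - a) l * (real (k - a) / (real (k - a) + l))"
    using binom2_Suc[of "k - Suc a" l] ka by simp
  also have "\<dots> \<le> (binom2 k l * (K / M) ^ a) * (K / M)"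
    using IH \<open>_ \<le> K / M\<close> binom2_pos[of k l] assms by (intro mult_mono) auto
  finally show ?case by (simp add: mult_ac)
qed simp

lemma binom2_diff_diff_le:
  assumes "a \<le> k" "b \<le> l" "real k \<le> K" "real l \<le> L" "0 < M" "M \<le> real (k - a) + real (l - b)"
  shows "binom2 (k - a) (l - b) \<le> binom2 k l * (K / M) ^ a * (L / M) ^ b"
proof -
  have "binom2 (k - a) (l - b) \<le> binom2 k (l - b) * (K / M) ^ a"
    using assms by (intro binom2_diff_le) auto
  also have "\<dots> \<le> (binom2 k l * (L / M) ^ b) * (K / M) ^ a"
    using binom2_diff_le[of b l L M k] assms
    by (intro mult_right_mono) (auto simp: binom2_commute[of k])
  finally show ?thesis by (simp add: mult_ac)
qed

text \<open>Source of the exponential gain: the ratio \<open>(k - j) / (k + l - j)\<close> is below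
  \<open>k / (k + l)\<close> by the factor \<open>1 - j * l / (k * (k + l))\<close> or more, and
  summing \<open>j < t\<close> in the exponent gives \<open>t * (t - 1) / 2\<close>.\<close>

lemma binom2_diff_decay:
  assumes "t \<le> k" "0 < k"
  shows "binom2 (k - t) l \<le> binom2 k l * (k / (k + l)) ^ t * exp (- (l / (k * (k + l))) * (real t * (real t - 1) / 2))"
  using assms(1)
proof (induction t)
  case (Suc t)
  have kt: "k - t = Suc (k - Suc t)" using Suc.prems by simp
  define x where "x = real l / (k * (k + l))"
  have kpos: "0 < real k" "0 < real k + real l" "0 < real k + l - t" using assms(2) Suc.prems by auto
  define N where "N = real k + l"
  have N: "0 < N" "0 < N - t" using kpos by (auto simp: N_def)
  have "real (k - t) / (real (k - t) + l) = (N - l - t) / (N - t)"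
    using Suc.prems by (simp add: N_def of_nat_diff algebra_simps)
  also have "\<dots> \<le> (N - l - t * (l / N)) / N"
  proof -
    have "(N - l - t * (l / N)) * (N - t) - (N - l - t) * N = real t * t * (l / N)"
      using N by (simp add: field_simps)
    moreover have "0 \<le> real t * t * (l / N)" using N by simp
    ultimately have "(N - l - t) * N \<le> (N - l - t * (l / N)) * (N - t)" by linarith
    then show ?thesis
      by (simp only: pos_divide_le_eq[OF N(2)] times_divide_eq_left pos_le_divide_eq[OF N(1)])
  qed
  also have "l / N = k * x" using kpos by (simp add: N_def x_def)
  also have "(N - l - t * (k * x)) / N = (k / (k + l)) * (1 - t * x)"
    by (simp add: N_def algebra_simps diff_divide_distrib add_divide_distrib)
  also have "\<dots> \<le> (k / (k + l)) * exp (- (t * x))"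
    using exp_ge_add_one_self[of "- (t * x)"] by (intro mult_left_mono) auto
  finally have fac: "real (k - t) / (real (k - t) + l) \<le> (k / (k + l)) * exp (- (t * x))" .
  have IH: "binom2 (k - t) l \<le> binom2 k l * (k / (k + l)) ^ t * exp (- x * (real t * (real t - 1) / 2))"
    using Suc unfolding x_def by simp
  have "binom2 (k - Suc t) l = binom2 (k - t) l * (real (k - t) / (real (k - t) + l))"
    using binom2_Suc[of "k - Suc t" l] kt by simp
  also have "\<dots> \<le> (binom2 k l * (k / (k + l)) ^ t * exp (- x * (real t * (real t - 1) / 2))) * ((k / (k + l)) * exp (- (t * x)))"
    using IH fac binom2_pos[of k l] by (intro mult_mono) auto
  also have "\<dots> = binom2 k l * (k / (k + l)) ^ Suc t * (exp (- x * (real t * (real t - 1) / 2)) * exp (- (t * x)))"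
    by simp
  also have "exp (- x * (real t * (real t - 1) / 2)) * exp (- (t * x)) = exp (- x * (real (Suc t) * (real (Suc t) - 1) / 2))"
  proof -
    have "- x * (real t * (real t - 1) / 2) + - (t * x) = - x * (real (Suc t) * (real (Suc t) - 1) / 2)"
      by (simp add: field_simps)
    then show ?thesis by (simp only: exp_add[symmetric])
  qed
  finally show ?case by (simp add: x_def)
qed simp

lemma exp_neg_double_le: "0 \<le> x \<Longrightarrow> x \<le> 1/2 \<Longrightarrow> exp (-2 * x) \<le> 1 - (x::real)"
proof -
  assume x: "0 \<le> x" "x \<le> 1/2"
  have "- 2 * x \<le> - x - 2 * x\<^sup>2"
    using mult_left_mono[of x "1/2" "2 * x"] x by (simp add: power2_eq_square)
  also have "\<dots> \<le> ln (1 - x)" using x by (rule ln_one_minus_pos_lower_bound)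
  finally show ?thesis using x by (simp add: ln_ge_iff)
qed

text \<open>A descent of \<open>t\<close> steps in one colour gains a factor \<open>exp (- l t (t - 1) / (2 k (k + l)))\<close>
  against the constant ratio \<open>k / (k + l)\<close>; a further mixed descent of \<open>s\<close> steps loses little.\<close>

lemma binom2_descent:
  fixes k l a b s t :: nat
  assumes "t + a \<le> k" "b \<le> l" "0 < k" "0 < l" "a + b \<le> s" "2 * (s + t) \<le> k + l"
  shows "binom2 (k - t - a) (l - b) \<le> binom2 k l * (k / (k + l)) ^ (a + t) * (l / (k + l)) ^ b
    * exp (2 * s * (s + t) / (k + l) - (l / (k * (k + l))) * (real t * (real t - 1) / 2))"
proof -
  define N where "N = real k + l"
  define M where "M = N - s - t"
  have N: "0 < N" using assms by (simp add: N_def)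
  have st: "2 * (real s + t) \<le> N"
    using of_nat_mono[OF assms(6), where 'a = real] unfolding N_def by simp
  have M: "0 < M" using N st unfolding M_def by argo
  \<comment> \<open>The \<open>a + b\<close> mixed steps use one crude denominator \<open>M\<close>.
    Passing back to \<open>N\<close> costs at most \<open>exp (2 * (s + t) / N)\<close> per step, as
    \<open>s + t\<close> is at most half of \<open>N\<close>.\<close>
  have "binom2 (k - t - a) (l - b) \<le> binom2 (k - t) l * (k / M) ^ a * (l / M) ^ b"
    using assms M by (intro binom2_diff_diff_le) (auto simp: M_def N_def of_nat_diff)
  also have "\<dots> = binom2 (k - t) l * ((k / N) ^ a * (l / N) ^ b * (N / M) ^ (a + b))"
    using N M by (simp add: power_add power_divide field_simps)
  also have "\<dots> \<le> (binom2 k l * (k / N) ^ t * exp (- (l / (k * (k + l))) * (real t * (real t - 1) / 2)))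
      * ((k / N) ^ a * (l / N) ^ b * exp (2 * s * (s + t) / (k + l)))"
  proof (intro mult_mono mult_left_mono)
    show "binom2 (k - t) l \<le> binom2 k l * (k / N) ^ t * exp (- (l / (k * (k + l))) * (real t * (real t - 1) / 2))"
      using binom2_diff_decay[of t k l] assms unfolding N_def by simp
    have "M / N = 1 - (real s + t) / N" using N unfolding M_def by (simp add: field_simps)
    then have M_N: "exp (- (2 * ((real s + t) / N))) \<le> M / N"
    proof -
      have "0 \<le> (real s + t) / N" "(real s + t) / N \<le> 1 / 2"
        using st N by (simp_all add: field_simps)
      from exp_neg_double_le[OF this] show ?thesis
        using \<open>M / N = _\<close> by (simp only: mult_minus_left)
    qed
    have "N / M \<le> exp (2 * ((real s + t) / N))"
      using le_imp_inverse_le[OF M_N exp_gt_zero] by (simp only: exp_minus inverse_inverse_eq inverse_divide)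
    then have "(N / M) ^ (a + b) \<le> exp (2 * ((real s + t) / N)) ^ (a + b)"
      using N M by (intro power_mono) auto
    also have "\<dots> \<le> exp (2 * ((real s + t) / N)) ^ s"
      using assms(5) N by (intro power_increasing) auto
    also have "\<dots> = exp (2 * s * (s + t) / (k + l))"
      by (simp add: N_def mult_ac flip: exp_of_nat_mult)
    finally show "(N / M) ^ (a + b) \<le> exp (2 * s * (s + t) / (k + l))" .
  qed (use N M binom2_pos[of k l] in auto)
  also have "\<dots> = binom2 k l * (k / (k + l)) ^ (a + t) * (l / (k + l)) ^ b
    * (exp (2 * s * (s + t) / (k + l)) * exp (- (l / (k * (k + l))) * (real t * (real t - 1) / 2)))"
    by (simp add: N_def power_add mult_ac)
  also have "exp (2 * s * (s + t) / (k + l)) * exp (- (l / (k * (k + l))) * (real t * (real t - 1) / 2))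
     = exp (2 * s * (s + t) / (k + l) - (l / (k * (k + l))) * (real t * (real t - 1) / 2))"
    by (simp flip: exp_add)
  finally show ?thesis .
qed

lemma ln_one_plus_ge_half: "0 \<le> x \<Longrightarrow> x \<le> 1 \<Longrightarrow> x / 2 \<le> ln (1 + (x::real))"
proof -
  assume x: "0 \<le> x" "x \<le> 1"
  have "ln (1 / (1 + x)) \<le> 1 / (1 + x) - 1" using x by (intro ln_le_minus_one) auto
  also have "\<dots> \<le> - (x / 2)"
  proof -
    have "x * x \<le> 1 * x" using x by (intro mult_right_mono)
    then show ?thesis using x by (simp add: field_simps)
  qed
  finally show ?thesis using x by (simp add: ln_div)
qed

text \<open>Supplies the price \<open>D\<close> of the book process. The left side is at most
  \<open>34 * sqrt \<mu>\<close>. For \<open>\<mu> \<le> t\<close> the logarithm is at least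
  \<open>\<mu> / (2 * t)\<close> and \<open>sqrt \<mu> \<le> \<mu> / sqrt \<mu>0\<close>; beyond
  \<open>t\<close> it is at least 1/2, and the upper bound on \<mu> yields
  \<open>sqrt \<mu> * sqrt \<mu>0 \<le> t\<close>.\<close>

lemma sqrt_le_ln_growth:
  fixes \<delta> \<mu>0 \<mu> t :: real
  assumes "1 \<le> \<mu>0" "0 < \<delta>" "0 < t" "\<mu>0 * exp 2 / \<delta> \<le> t" "\<mu>0 \<le> \<mu>" "\<mu> \<le> t * exp 2 / \<delta>"
  shows "16 + 9 * sqrt (\<mu> + 1) \<le> 68 * t / sqrt \<mu>0 * ln (1 + \<mu> / t)"
proof -
  have \<mu>: "1 \<le> \<mu>" using assms by linarith
  have s1: "1 \<le> sqrt \<mu>" using \<mu> by simp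
  have "sqrt (\<mu> + 1) \<le> sqrt (4 * \<mu>)" using \<mu> by (intro real_sqrt_le_mono) linarith
  also have "\<dots> = 2 * sqrt \<mu>" by (simp add: real_sqrt_mult)
  finally have le: "16 + 9 * sqrt (\<mu> + 1) \<le> 34 * sqrt \<mu>" using s1 by linarith
  have s0: "0 < sqrt \<mu>0" using assms by simp
  show ?thesis
  proof (cases "\<mu> \<le> t")
    case True
    have "sqrt \<mu>0 * sqrt \<mu> \<le> sqrt \<mu> * sqrt \<mu>" using assms(5) s1 by (intro mult_right_mono) auto
    then have "sqrt \<mu> \<le> \<mu> / sqrt \<mu>0" using s0 \<mu> by (simp add: field_simps)
    then have "34 * sqrt \<mu> \<le> 68 * t / sqrt \<mu>0 * ((\<mu> / t) / 2)"
      using assms(3) by simp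
    also have "\<dots> \<le> 68 * t / sqrt \<mu>0 * ln (1 + \<mu> / t)"
      using assms(3) s0 \<mu> True by (intro mult_left_mono ln_one_plus_ge_half) auto
    finally show ?thesis using le by linarith
  next
    case False
    have "\<mu> * \<mu>0 \<le> (t * exp 2 / \<delta>) * \<mu>0" using assms by (intro mult_right_mono) auto
    also have "\<dots> = t * (\<mu>0 * exp 2 / \<delta>)" by simp
    also have "\<dots> \<le> t * t" using assms by (intro mult_left_mono) auto
    finally have "sqrt (\<mu> * \<mu>0) \<le> sqrt (t * t)" by (rule real_sqrt_le_mono)
    then have "sqrt \<mu> * sqrt \<mu>0 \<le> t" using assms(3) by (simp add: real_sqrt_mult)
    then have "34 * sqrt \<mu> \<le> 68 * t / sqrt \<mu>0 * (1 / 2)" using s0 by (simp add: field_simps)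
    also have "1 / 2 \<le> ln (2::real)" using ln2_ge_two_thirds by simp
    then have "68 * t / sqrt \<mu>0 * (1 / 2) \<le> 68 * t / sqrt \<mu>0 * ln (1 + \<mu> / t)"
    proof (intro mult_left_mono)
      assume "1 / 2 \<le> ln (2::real)"
      also have "ln 2 \<le> ln (1 + \<mu> / t)" using False assms(3) by (intro ln_mono) (auto simp: field_simps)
      finally show "1 / 2 \<le> ln (1 + \<mu> / t)" .
    qed (use assms s0 in auto)
    finally show ?thesis using le by linarith
  qed
qed

section \<open>The exponential improvement\<close>

lemma binom2_ge_power: "0 < l \<Longrightarrow> l \<le> k \<Longrightarrow> 2 ^ l \<le> binom2 k l"
proof -
  assume l: "0 < l" "l \<le> k"
  have "(2::real) ^ l \<le> (real (k + l) / real l) ^ l"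
    using l by (intro power_mono) (auto simp: field_simps)
  also have "\<dots> \<le> real ((k + l) choose l)"
    using binomial_ge_n_over_k_pow_k[of l "k + l", where 'a = real] by simp
  also have "\<dots> = binom2 k l"
    using binom2_commute[of k l] by (simp add: binom2_def add.commute)
  finally show ?thesis .
qed

lemma nat_ceiling_bounds:
  fixes x :: real assumes "1 \<le> x" shows "x \<le> nat \<lceil>x\<rceil>" "nat \<lceil>x\<rceil> \<le> 2 * x"
  using assms by linarith+

text \<open>The book size is about \<open>\<nu> * k\<close>, the budget of degree steps about
  \<open>\<sigma> * k\<close>. C1 bounds the loss of the boosts in the pages, C3 makes
  \<open>ln (card W)\<close> linear in \<open>k\<close>, C2 keeps the consumption of the process
  below it, and C4 ensures that all steps together use at most half of \<open>l\<close>.\<close>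

lemma ramsey_core:
  fixes \<epsilon> \<delta> \<nu> \<eta> \<sigma> c \<mu>0 :: real and k l :: nat
  assumes sym: "symp E" and \<epsilon>: "0 < \<epsilon>" "\<epsilon> < 1/2" and \<delta>: "0 < \<delta>" "\<delta> \<le> \<epsilon> / 12"
    and params: "\<nu> = 112 * \<delta> / \<epsilon>\<^sup>2" "\<eta> = \<delta> * \<epsilon> / 8" "\<sigma> = \<eta> / 16" "c = \<eta>\<^sup>2 / 64"
    and \<mu>0: "1 \<le> \<mu>0"
    and C1: "2 / \<mu>0 * (ln (1 / \<delta>) + 2) * ln (4 / \<epsilon>) \<le> \<delta> / \<epsilon>"
    and C2: "4 * \<nu> * (17 + 9 * sqrt (\<mu>0 + 1)) + 272 * \<nu> / sqrt \<mu>0 * (ln (1 / \<delta>) + 2) \<le> \<epsilon> / 4"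
    and C3: "c + 2 * \<sigma> * ln (2 / \<epsilon>) \<le> \<epsilon> / 10"
    and C4: "2 * \<sigma> + 2 * \<nu> \<le> \<epsilon> / 2"
    and kl: "\<epsilon> * k \<le> l" "l \<le> k"
    and K: "1 \<le> \<sigma> * k" "\<mu>0 * exp 2 / \<delta> \<le> \<nu> * k" "2 \<le> \<nu> * k" "8 \<le> \<epsilon> * k" "16 / (\<delta> * \<epsilon>) \<le> \<epsilon> * k"
    and V: "finite V" "exp (- c * k) * binom2 k l \<le> card V"
  shows "has_mono E V True (k + 1) \<or> has_mono E V False (l + 1)"
proof -
  define N where "N = real (k + l)"
  define q where "q i = real (if i then k else l) / N" for i
  have k: "0 < k" using K(4) by (cases k) auto
  have l: "0 < l"
  proof -
    have "0 < \<epsilon> * k" using \<epsilon> k by simp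
    then show ?thesis using kl by (cases l) auto
  qed
  have N: "0 < N" "k \<le> N" "N \<le> 2 * real k" using k kl by (auto simp: N_def)
  have qF: "\<epsilon> / 2 \<le> q False"
  proof -
    have "\<epsilon> * N \<le> \<epsilon> * (2 * real k)" using \<epsilon> N by (intro mult_left_mono) auto
    then have "\<epsilon> * N \<le> 2 * l" using kl by linarith
    then show ?thesis using N by (simp add: q_def field_simps)
  qed
  have qT: "1 / 2 \<le> q True" using N by (simp add: q_def field_simps)
  have q_sum: "q True + q False = 1"
    using N unfolding q_def by (simp add: N_def flip: add_divide_distrib)
  have q_ge: "\<epsilon> / 2 \<le> q i" for i using qF qT \<epsilon> by (cases i) auto
  have q_pos: "0 < q i" for i using q_ge[of i] \<epsilon> by linarith
  have q_le: "q i \<le> 1" for i using q_sum q_pos[of True] q_pos[of False] by (cases i) auto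
  have \<eta>: "0 < \<eta>" "\<eta> \<le> 1"
  proof -
    show "0 < \<eta>" using \<delta> \<epsilon> unfolding params(2) by simp
    have "\<delta> * \<epsilon> \<le> 1 * 1" using \<delta> \<epsilon> by (intro mult_mono) auto
    then show "\<eta> \<le> 1" by (simp add: params)
  qed
  have \<sigma>: "0 < \<sigma>" using \<eta> unfolding params(3) by simp
  have \<nu>: "0 < \<nu>" using \<delta> \<epsilon> unfolding params(1) by simp
  have \<epsilon>2: "\<epsilon>\<^sup>2 \<le> 1" using \<epsilon> by (simp add: power_le_one)
  have \<delta>\<epsilon>: "\<delta> * \<epsilon> \<le> \<delta> / \<epsilon>"
  proof -
    have "\<delta> * \<epsilon>\<^sup>2 \<le> \<delta> * 1" using \<epsilon>2 \<delta> by (intro mult_left_mono) auto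
    then show ?thesis using \<epsilon> by (simp add: field_simps power2_eq_square)
  qed
  have \<delta>_le: "\<delta> \<le> \<nu>"
  proof -
    have "\<delta> * \<epsilon>\<^sup>2 \<le> 112 * \<delta>" using mult_left_mono[OF \<epsilon>2, of \<delta>] \<delta> by linarith
    then show ?thesis using \<epsilon> by (simp add: params field_simps)
  qed
  have \<eta>_le: "\<eta> \<le> \<delta> / 8"
    using mult_left_mono[of \<epsilon> 1 \<delta>] \<epsilon> \<delta> unfolding params(2) by simp
  have \<sigma>\<nu>: "2 * \<sigma> \<le> \<nu>" using \<delta>_le \<eta>_le \<delta> unfolding params(3) by linarith

  define s where "s = nat \<lceil>\<sigma> * k\<rceil>"
  define t where "t = nat \<lceil>\<nu> * k\<rceil>"
  have s: "\<sigma> * k \<le> s" "s \<le> 2 * (\<sigma> * k)" unfolding s_def using K(1) by (rule nat_ceiling_bounds)+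
  have t: "\<nu> * k \<le> t" "t \<le> 2 * (\<nu> * k)" unfolding t_def using K(3) by (intro nat_ceiling_bounds; linarith)+
  note t_ge = t(1)
  have t2: "2 \<le> t" using t K by linarith
  have s_le_t: "s \<le> t"
  proof -
    have "2 * \<sigma> * k \<le> \<nu> * k" using \<sigma>\<nu> by (intro mult_right_mono) auto
    then show ?thesis using s t by linarith
  qed
  have st: "2 * (s + t) \<le> l"
  proof -
    have "(2 * \<sigma> + 2 * \<nu>) * k \<le> \<epsilon> / 2 * k" using C4 by (intro mult_right_mono) auto
    then have "real (2 * (s + t)) \<le> l" using s t kl by (simp add: distrib_right)
    then show ?thesis by linarith
  qed

  have g_nonneg: "0 \<le> (1 + \<eta>) * q i" for i using \<eta> q_pos[of i] by simp
  obtain a W where W: "W \<subseteq> V"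
    and ext': "\<forall>i u. has_mono E W i u \<longrightarrow> has_mono E V i (u + a i)"
    and cardW: "((1 + \<eta>) * q True) ^ a True * ((1 + \<eta>) * q False) ^ a False * card V \<le> card W"
    and alt: "a True + a False = s \<or> a True + a False < s \<and>
       (\<forall>i. \<forall>x\<in>W. card (nbr E i x \<inter> W) < (1 + \<eta>) * q i * card W)"
    using regularise[where g = "\<lambda>i. (1 + \<eta>) * q i" and V = V and m = s, OF sym g_nonneg]
    by (elim exE conjE)
  have ext: "has_mono E V i (u + a i)" if "has_mono E W i u" for i u
    using ext' that by blast
  define F where "F = q True ^ a True * q False ^ a False"
  have F: "0 < F" using q_pos by (simp add: F_def)
  have asum: "a True + a False \<le> s" using alt by auto
  have ak: "t + a True \<le> k" "a True \<le> k" "a False \<le> l" "t + a False \<le> l" using asum st kl by auto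
  have finW: "finite W" using W V(1) by (rule finite_subset)
  have cardW': "(1 + \<eta>) ^ (a True + a False) * F * (exp (- c * k) * binom2 k l) \<le> card W"
  proof -
    have "(1 + \<eta>) ^ (a True + a False) * F * (exp (- c * k) * binom2 k l)
        \<le> (1 + \<eta>) ^ (a True + a False) * F * card V"
      using \<eta> F V(2) by (intro mult_left_mono) auto
    also have "\<dots> \<le> card W" using cardW by (simp add: F_def power_mult_distrib power_add mult_ac)
    finally show ?thesis .
  qed
  \<comment> \<open>Both outcomes end here: with \<open>d i\<close> vertices of colour
    \<open>i\<close> already secured for extending cliques in \<open>U\<close>, the Erdos-Szekeres
    bound is needed only for the reduced sizes.\<close>
  have finish: "has_mono E V True (k + 1) \<or> has_mono E V False (l + 1)"
    if U: "finite U" "\<And>i u. has_mono E U i u \<Longrightarrow> has_mono E V i (u + d i)"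
      and d: "d True \<le> k" "d False \<le> l" and card: "binom2 (k - d True) (l - d False) \<le> card U"
    for U d
  proof -
    have "((k - d True) + (l - d False)) choose (k - d True) \<le> card U"
      using card unfolding binom2_def by linarith
    from erdos_szekeres[OF sym U(1) this] show ?thesis
      using U(2)[of True "k - d True + 1"] U(2)[of False "l - d False + 1"] d by auto
  qed
  \<comment> \<open>\<open>c\<close> is \<open>\<eta> / 4 * \<sigma>\<close>. Each of
    \<open>s\<close> degree steps gains at least \<open>\<eta> / 2\<close> in the exponent; one half
    pays for \<open>exp (- c * k)\<close>, the other for the loss \<open>2 * s * s / N\<close> of
    the descent.\<close>
  have c_k: "c * k \<le> \<eta> / 4 * s"
  proof -
    have "c * k = \<eta> / 4 * (\<sigma> * k)" by (simp add: params(3,4) power2_eq_square)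
    also have "\<dots> \<le> \<eta> / 4 * s" using s \<eta> by (intro mult_left_mono) auto
    finally show ?thesis .
  qed
  show ?thesis
  proof (cases "a True + a False = s")
    case True
    have "binom2 (k - a True) (l - a False) \<le> binom2 k l * F * exp (2 * real s * real s / N)"
      using binom2_descent[of 0 "a True" k "a False" l s] ak asum st k l
      by (simp add: F_def q_def N_def mult_ac)
    also have "\<dots> \<le> binom2 k l * F * ((1 + \<eta>) ^ s * exp (- c * k))"
    proof (intro mult_left_mono)
      have "2 * real s * real s / N \<le> 2 * real s * real s / k" using N k by (intro divide_left_mono) auto
      also have "\<dots> \<le> 2 * real s * (2 * (\<sigma> * k)) / k" using s by (intro divide_right_mono mult_left_mono) auto
      also have "\<dots> = \<eta> / 4 * s" using k by (simp add: params(3))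
      finally have "2 * real s * real s / N \<le> \<eta> / 4 * s" .
      moreover have "s * (\<eta> / 2) = \<eta> / 4 * s + \<eta> / 4 * s" by (simp add: field_simps)
      ultimately have "2 * real s * real s / N \<le> s * (\<eta> / 2) + (- c * k)" using c_k by linarith
      also have "\<dots> \<le> s * ln (1 + \<eta>) + (- c * k)"
        using \<eta> by (intro add_right_mono mult_left_mono ln_one_plus_ge_half) auto
      finally have "exp (2 * real s * real s / N) \<le> exp (s * ln (1 + \<eta>) + (- c * k))" by simp
      also have "\<dots> = (1 + \<eta>) ^ s * exp (- c * k)"
        using \<eta> unfolding exp_add by (simp add: exp_of_nat_mult)
      finally show "exp (2 * real s * real s / N) \<le> (1 + \<eta>) ^ s * exp (- c * k)" .
    qed (use F binom2_pos[of k l] in auto)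
    also have "\<dots> \<le> card W" using cardW' True by (simp add: mult_ac)
    finally show ?thesis by (intro finish[OF finW ext]) (use ak in auto)
  next
    case False
    then have reg: "\<And>i x. x \<in> W \<Longrightarrow> card (nbr E i x \<inter> W) < (1 + \<eta>) * q i * card W"
      using alt by blast
    have W1: "F * (exp (- c * k) * binom2 k l) \<le> card W"
    proof -
      have "1 * (F * (exp (- c * k) * binom2 k l)) \<le> (1 + \<eta>) ^ (a True + a False) * (F * (exp (- c * k) * binom2 k l))"
        using \<eta> F binom2_pos[of k l] by (intro mult_right_mono one_le_power) auto
      then show ?thesis using cardW' by (simp add: mult_ac)
    qed
    have W_pos: "0 < card W"
    proof -
      have "0 < F * (exp (- c * k) * binom2 k l)" using F binom2_pos[of k l] by simp
      then show ?thesis using W1 by linarith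
    qed
    \<comment> \<open>From \<open>2 ^ l\<close> the logarithm starts at
      \<open>2 / 3 * \<epsilon> * k\<close> or more; the degree steps and
      \<open>exp (- c * k)\<close> lose at most a tenth of \<open>\<epsilon> * k\<close>.\<close>
    have lnW: "\<epsilon> / 2 * k \<le> ln (card W)"
    proof -
      have "(\<epsilon> / 2) ^ s \<le> (\<epsilon> / 2) ^ (a True + a False)"
        using asum \<epsilon> by (intro power_decreasing) auto
      also have "\<dots> \<le> F" unfolding F_def power_add
        using q_ge \<epsilon> by (intro mult_mono power_mono) (auto intro: zero_le_power less_imp_le[OF q_pos])
      finally have Fge: "(\<epsilon> / 2) ^ s \<le> F" .
      have "(\<epsilon> / 2) ^ s * (exp (- c * k) * 2 ^ l) \<le> F * (exp (- c * k) * binom2 k l)"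
        using Fge binom2_ge_power[OF l kl(2)] F by (intro mult_mono) auto
      also have "\<dots> \<le> card W" by (rule W1)
      finally have "ln ((\<epsilon> / 2) ^ s * (exp (- c * k) * 2 ^ l)) \<le> ln (card W)"
        by (rule ln_mono) (use \<epsilon> in auto)
      then have le: "s * ln (\<epsilon> / 2) + (- c * k + l * ln 2) \<le> ln (card W)"
        using \<epsilon> by (simp add: ln_mult ln_realpow)
      have ln_neg: "ln (\<epsilon> / 2) = - ln (2 / \<epsilon>)" using \<epsilon> by (simp add: ln_div)
      have "s * ln (2 / \<epsilon>) \<le> 2 * (\<sigma> * k) * ln (2 / \<epsilon>)"
        using s \<epsilon> by (intro mult_right_mono) auto
      moreover have "(c + 2 * \<sigma> * ln (2 / \<epsilon>)) * k \<le> \<epsilon> / 10 * k" using C3 by (intro mult_right_mono) auto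
      moreover have "(\<epsilon> * k) * (2 / 3) \<le> l * ln 2"
        using kl \<epsilon> ln2_ge_two_thirds by (intro mult_mono) auto
      moreover have "0 \<le> \<epsilon> * k" using \<epsilon> by simp
      ultimately show ?thesis using le unfolding ln_neg by (simp add: algebra_simps)
    qed
    have W_large: "8 / (\<delta> * \<epsilon>) \<le> card W"
    proof -
      have "8 / (\<delta> * \<epsilon>) \<le> \<epsilon> / 2 * k" using K(5) by simp
      also have "\<dots> \<le> ln (card W)" by (rule lnW)
      also have "\<dots> \<le> card W" using W_pos ln_le_minus_one[of "real (card W)"] by simp
      finally show ?thesis .
    qed
    \<comment> \<open>An upper degree bound in one colour is a lower bound in the other. The error
      \<open>1 + \<eta> * w\<close> fits into \<open>\<delta> * q i * w\<close> by the choice of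
      \<eta> and the size of \<open>W\<close>.\<close>
    have deg: "(1 - \<delta>) * q i * card W \<le> card (nbr E i x \<inter> W)" if x: "x \<in> W" for i x
    proof -
      define w where "w = real (card W)"
      have w: "0 \<le> w" by (simp add: w_def)
      have q': "q (\<not> i) = 1 - q i" using q_sum by (cases i) auto
      have "w = 1 + card (nbr E i x \<inter> W) + card (nbr E (\<not> i) x \<inter> W)"
        using card_nbr_split[OF finW x, of E i] by (simp add: w_def)
      moreover have "card (nbr E (\<not> i) x \<inter> W) \<le> (1 + \<eta>) * (1 - q i) * w"
        using reg[OF x, of "\<not> i"] unfolding q' w_def by linarith
      moreover have "\<eta> * (1 - q i) * w \<le> \<eta> * 1 * w"
        using \<eta> q_pos[of i] w by (intro mult_right_mono mult_left_mono) auto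
      moreover have "1 + \<eta> * w \<le> \<delta> * q i * w"
      proof -
        have "\<delta> * (\<epsilon> / 2) * w \<le> \<delta> * q i * w" using \<delta> q_ge w by (intro mult_right_mono mult_left_mono) auto
        moreover have "8 \<le> \<delta> * \<epsilon> * w"
          using W_large \<delta> \<epsilon> unfolding w_def by (simp add: divide_le_eq mult_ac)
        ultimately show ?thesis by (simp add: params(2))
      qed
      ultimately show ?thesis unfolding w_def[symmetric] by (simp add: algebra_simps)
    qed
    have deg_all: "\<forall>i. \<forall>x\<in>W. (1 - \<delta>) * q i * card W \<le> card (nbr E i x \<inter> W)"
      using deg by blast
    have p0: "q i * exp (- (6 * \<delta> / \<epsilon>)) \<le> (1 - \<delta>) * q i - \<delta>" for i
    proof -
      have "exp (-2 * (3 * \<delta> / \<epsilon>)) \<le> 1 - 3 * \<delta> / \<epsilon>"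
        using \<delta> \<epsilon> by (intro exp_neg_double_le) (auto simp: field_simps)
      then have "q i * exp (- (6 * \<delta> / \<epsilon>)) \<le> q i * (1 - 3 * \<delta> / \<epsilon>)"
        using q_pos[of i] by (intro mult_left_mono) auto
      also have "\<dots> \<le> (1 - \<delta>) * q i - \<delta>"
      proof -
        have "\<delta> * \<epsilon> / 2 \<le> \<delta> * q i" using mult_left_mono[OF q_ge[of i], of \<delta>] \<delta> by simp
        then have "\<delta> \<le> 2 * (\<delta> / \<epsilon>) * q i" using \<epsilon> by (simp add: field_simps)
        moreover have "\<delta> * q i \<le> (\<delta> / \<epsilon>) * q i"
          using \<delta> \<epsilon> q_pos[of i] by (intro mult_right_mono) (auto simp: field_simps)
        moreover have eq1: "q i * (1 - 3 * \<delta> / \<epsilon>) = q i - 2 * (\<delta> / \<epsilon>) * q i - (\<delta> / \<epsilon>) * q i"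
          using \<epsilon> by (simp add: field_simps)
        moreover have eq2: "(1 - \<delta>) * q i - \<delta> = q i - \<delta> * q i - \<delta>" by (simp add: left_diff_distrib)
        ultimately show ?thesis unfolding eq1 eq2 by linarith
      qed
      finally show ?thesis .
    qed
    have p0_gt: "\<epsilon> / 4 \<le> (1 - \<delta>) * q i - \<delta>" "\<delta> < (1 - \<delta>) * q i" for i
    proof -
      have "(1 - \<delta>) * (\<epsilon> / 2) \<le> (1 - \<delta>) * q i" using \<delta> \<epsilon> q_ge by (intro mult_left_mono) auto
      moreover have "\<delta> * \<epsilon> \<le> \<delta> * (1 / 2)" using \<delta> \<epsilon> by (intro mult_left_mono) auto
      moreover have "(1 - \<delta>) * (\<epsilon> / 2) = \<epsilon> / 2 - \<delta> * \<epsilon> / 2" by (simp add: field_simps)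
      ultimately show "\<epsilon> / 4 \<le> (1 - \<delta>) * q i - \<delta>" using \<delta> by linarith
      then show "\<delta> < (1 - \<delta>) * q i" using \<epsilon> by linarith
    qed
    have \<mu>0_t: "\<mu>0 * exp 2 / \<delta> \<le> t" using K(2) t by linarith
    have \<mu>0_le: "\<mu>0 \<le> t"
    proof -
      have "\<mu>0 * 1 \<le> \<mu>0 * (exp 2 / \<delta>)"
        using \<delta> \<epsilon> \<mu>0 exp_ge_add_one_self[of "2::real"] by (intro mult_left_mono) (auto simp: field_simps)
      then show ?thesis using \<mu>0_t by simp
    qed
    have ln\<delta>: "0 \<le> ln (1 / \<delta>) + 2" using \<delta> \<epsilon> by (intro add_nonneg_nonneg) auto
    interpret book_process E "\<lambda>i. (1 - \<delta>) * q i" \<delta> \<mu>0 "68 * real t / sqrt \<mu>0" "2 * real t / \<mu>0" t W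
    proof
      show "symp E" "0 < \<delta>" "2 \<le> t" "finite W" by (fact sym \<delta>(1) t2 finW)+
      show "\<delta> < (1 - \<delta>) * q i" for i by (rule p0_gt)
      show "(1 - \<delta>) * q i \<le> 1" for i
        using q_le[of i] q_pos[of i] \<delta> \<epsilon> by (intro mult_le_one) auto
      show "0 \<le> 68 * real t / sqrt \<mu>0" "0 \<le> \<mu>0" "0 \<le> 2 * real t / \<mu>0" using \<mu>0 by auto
      show "16 + 9 * sqrt (\<mu> + 1) \<le> 68 * real t / sqrt \<mu>0 * ln (1 + \<mu> / t)"
        if "\<mu>0 \<le> \<mu>" "\<mu> \<le> t * exp 2 / \<delta>" for \<mu>
        using \<mu>0 \<delta> t2 \<mu>0_t that by (intro sqrt_le_ln_growth) auto
      have "\<mu>0 / t / 2 \<le> ln (1 + \<mu>0 / t)"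
        using \<mu>0 \<mu>0_le by (intro ln_one_plus_ge_half) auto
      then have "2 * real t / \<mu>0 * (\<mu>0 / t / 2) \<le> 2 * real t / \<mu>0 * ln (1 + \<mu>0 / t)"
        using \<mu>0 by (intro mult_left_mono) auto
      then show "1 \<le> 2 * real t / \<mu>0 * ln (1 + \<mu>0 / t)" using \<mu>0 t2 by simp
      show "W \<noteq> {}" using W_pos by auto
      show "2 * t * (17 + 9 * sqrt (\<mu>0 + 1)) + 2 * (68 * real t / sqrt \<mu>0) * (ln (1 / \<delta>) + 2) + 2 \<le> ln (card W)"
      proof -
        define A where "A = 2 * (17 + 9 * sqrt (\<mu>0 + 1)) + 136 / sqrt \<mu>0 * (ln (1 / \<delta>) + 2)"
        have A: "0 \<le> A" using ln\<delta> \<mu>0 by (auto simp: A_def intro!: add_nonneg_nonneg mult_nonneg_nonneg)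
        have "2 * t * (17 + 9 * sqrt (\<mu>0 + 1)) + 2 * (68 * real t / sqrt \<mu>0) * (ln (1 / \<delta>) + 2) = t * A"
          by (simp add: A_def algebra_simps)
        also have "\<dots> \<le> 2 * (\<nu> * k) * A" using t A by (intro mult_right_mono) auto
        also have "\<dots> = (2 * \<nu> * A) * k" by simp
        also have "2 * \<nu> * A = 4 * \<nu> * (17 + 9 * sqrt (\<mu>0 + 1)) + 272 * \<nu> / sqrt \<mu>0 * (ln (1 / \<delta>) + 2)"
          by (simp add: A_def algebra_simps)
        also have "\<dots> * k \<le> \<epsilon> / 4 * k" using C2 by (intro mult_right_mono) auto
        finally show ?thesis using lnW K(4) by simp
      qed
    qed
    obtain i A B where AB: "A \<subseteq> W" "B \<subseteq> W" "mono_on_colour E i A" "card A = t"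
      "\<forall>x\<in>A. B \<subseteq> nbr E i x" "0 < card B"
      "ln (card W) - (t + 2 * real t / \<mu>0 * (ln (1 / \<delta>) + 2)) * ln (1 / ((1 - \<delta>) * q i - \<delta>)) \<le> ln (card B)"
      using exists_book[OF deg_all] by (elim exE conjE)
    have finA: "finite A" and finB: "finite B" using AB finW by (auto intro: finite_subset)
    define r where "r = (1 - \<delta>) * q i - \<delta>"
    have r: "\<epsilon> / 4 \<le> r" "q i * exp (- (6 * \<delta> / \<epsilon>)) \<le> r" "0 < r"
      using p0_gt(1)[of i] p0[of i] \<epsilon> by (auto simp: r_def)
    \<comment> \<open>Of the 7 units of \<open>\<delta> / \<epsilon>\<close> lost per clique vertex,
      6 come from the density floor and 1 from the boosts, by C1.\<close>
    have cardB: "card W * q i ^ t * exp (- (7 * \<delta> / \<epsilon> * t)) \<le> card B"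
    proof -
      have "ln (q i * exp (- (6 * \<delta> / \<epsilon>))) \<le> ln r" using r q_pos by (intro ln_mono) auto
      then have "ln (1 / r) \<le> 6 * \<delta> / \<epsilon> - ln (q i)" using r q_pos[of i] by (simp add: ln_mult ln_div)
      then have "t * ln (1 / r) \<le> t * (6 * \<delta> / \<epsilon> - ln (q i))" by (intro mult_left_mono) auto
      moreover have "2 * real t / \<mu>0 * (ln (1 / \<delta>) + 2) * ln (1 / r) \<le> t * (\<delta> / \<epsilon>)"
      proof -
        have "1 / r \<le> 4 / \<epsilon>" using r \<epsilon> by (simp add: field_simps)
        then have "ln (1 / r) \<le> ln (4 / \<epsilon>)" using r by (intro ln_mono) auto
        then have "2 / \<mu>0 * (ln (1 / \<delta>) + 2) * ln (1 / r) \<le> 2 / \<mu>0 * (ln (1 / \<delta>) + 2) * ln (4 / \<epsilon>)"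
          using \<mu>0 ln\<delta> by (intro mult_left_mono) auto
        also note C1
        finally have "t * (2 / \<mu>0 * (ln (1 / \<delta>) + 2) * ln (1 / r)) \<le> t * (\<delta> / \<epsilon>)"
          by (intro mult_left_mono) auto
        then show ?thesis by (simp add: mult_ac)
      qed
      moreover have "(t + 2 * real t / \<mu>0 * (ln (1 / \<delta>) + 2)) * ln (1 / r)
          = t * ln (1 / r) + 2 * real t / \<mu>0 * (ln (1 / \<delta>) + 2) * ln (1 / r)" by (rule distrib_right)
      moreover have "t * (6 * \<delta> / \<epsilon> - ln (q i)) + t * (\<delta> / \<epsilon>) = 7 * \<delta> / \<epsilon> * t - t * ln (q i)"
        using \<epsilon> by (simp add: field_simps)
      ultimately have "(t + 2 * real t / \<mu>0 * (ln (1 / \<delta>) + 2)) * ln (1 / r) \<le> 7 * \<delta> / \<epsilon> * t - t * ln (q i)"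
        by linarith
      then have "ln (card W) + t * ln (q i) - 7 * \<delta> / \<epsilon> * t \<le> ln (card B)"
        using AB(7) unfolding r_def by linarith
      also have "ln (card W) + t * ln (q i) - 7 * \<delta> / \<epsilon> * t = ln (card W * q i ^ t * exp (- (7 * \<delta> / \<epsilon> * t)))"
        using W_pos q_pos[of i] by (simp add: ln_mult ln_realpow)
      finally show ?thesis using W_pos q_pos[of i] AB(6) by (subst (asm) ln_le_cancel_iff) auto
    qed
    \<comment> \<open>One exponent for both colours: \<open>\<epsilon> / (2 * k)\<close> is at most
      either of the rates \<open>l / (k * (k + l))\<close> and
      \<open>k / (l * (k + l))\<close>.\<close>
    define g where "g = 2 * real s * (real s + real t) / N - \<epsilon> / (2 * k) * (real t * (real t - 1) / 2)"
    \<comment> \<open>In units of \<open>\<delta> / \<epsilon> * t\<close>, the quadratic gain is at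
      least 14, while \<open>c * k\<close> and the mixed descent take at most 1 each, so the
      required 7 remain.\<close>
    have g_le: "g \<le> - (7 * \<delta> / \<epsilon> * t) - c * k"
    proof -
      have "c * k \<le> \<delta> / \<epsilon> * t"
      proof -
        have "\<eta> / 4 * s \<le> (\<delta> / \<epsilon>) * t"
        proof (rule mult_mono)
          show "\<eta> / 4 \<le> \<delta> / \<epsilon>" using \<delta>\<epsilon> \<eta>(1) unfolding params(2) by linarith
        qed (use s_le_t \<delta> \<epsilon> in auto)
        then show ?thesis using c_k by linarith
      qed
      moreover have "2 * real s * (real s + real t) / N \<le> \<delta> / \<epsilon> * t"
      proof -
        have "2 * real s * (real s + real t) / N \<le> 2 * real s * (real s + real t) / k" using N k by (intro divide_left_mono) auto
        also have "\<dots> \<le> 2 * (2 * (\<sigma> * k)) * (2 * real t) / k"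
          using s s_le_t \<sigma> by (intro divide_right_mono mult_mono) auto
        also have "\<dots> = 8 * \<sigma> * t" using k by simp
        also have "\<dots> \<le> \<delta> / \<epsilon> * t"
        proof (rule mult_right_mono)
          show "8 * \<sigma> \<le> \<delta> / \<epsilon>" using \<delta>\<epsilon> \<eta>(1) unfolding params(2,3) by linarith
        qed simp
        finally show ?thesis .
      qed
      moreover have "14 * \<delta> / \<epsilon> * t \<le> \<epsilon> / (2 * k) * (real t * (real t - 1) / 2)"
      proof -
        \<comment> \<open>The 112 in \<nu> is 8 * 14, with 8 the denominator that arises from
          bounding \<open>t - 1\<close> below by \<open>t / 2\<close>.\<close>
        have "14 * \<delta> / \<epsilon> * t = \<epsilon> / (8 * k) * (t * (\<nu> * k))"
          using k \<epsilon> by (simp add: params(1) field_simps power2_eq_square)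
        also have "\<dots> \<le> \<epsilon> / (8 * k) * (t * real t)"
          using t_ge \<epsilon> by (intro mult_left_mono) auto
        also have "\<dots> = \<epsilon> / (2 * k) * (t * (real t / 2) / 2)" by simp
        also have "\<dots> \<le> \<epsilon> / (2 * k) * (real t * (real t - 1) / 2)"
          using t2 \<epsilon> by (intro mult_left_mono divide_right_mono) auto
        finally show ?thesis .
      qed
      moreover have "0 \<le> \<delta> / \<epsilon> * t" using \<delta> \<epsilon> by simp
      ultimately show ?thesis unfolding g_def by simp
    qed
    define d where "d j = a j + (if j = i then t else 0)" for j
    have main: "binom2 (k - d True) (l - d False) \<le> binom2 k l * F * q i ^ t * exp g"
    proof -
      have tt: "0 \<le> real t * (real t - 1) / 2" using t2 by simp
      show ?thesis
      proof (cases i)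
        case True
        have "\<epsilon> / (2 * k) = (\<epsilon> / 2) / k" by simp
        also have "\<dots> \<le> q False / k" using qF by (intro divide_right_mono) auto
        also have "\<dots> = l / (k * (k + l))" by (simp add: q_def N_def)
        finally have "\<epsilon> / (2 * k) * (real t * (real t - 1) / 2) \<le> l / (k * (k + l)) * (real t * (real t - 1) / 2)"
          by (rule mult_right_mono[OF _ tt])
        then have ex: "exp (2 * s * (s + t) / (k + l) - (l / (k * (k + l))) * (real t * (real t - 1) / 2)) \<le> exp g"
          unfolding g_def N_def by simp
        have "binom2 (k - d True) (l - d False) = binom2 (k - t - a True) (l - a False)"
          using True by (simp add: d_def add.commute)
        also have "\<dots> \<le> binom2 k l * (k / (k + l)) ^ (a True + t) * (l / (k + l)) ^ a False
            * exp (2 * s * (s + t) / (k + l) - (l / (k * (k + l))) * (real t * (real t - 1) / 2))"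
          using ak asum st k l by (intro binom2_descent) auto
        also have "\<dots> \<le> binom2 k l * (k / (k + l)) ^ (a True + t) * (l / (k + l)) ^ a False * exp g"
          using binom2_pos[of k l] by (intro mult_left_mono ex) auto
        also have "\<dots> = binom2 k l * F * q i ^ t * exp g"
          using True by (simp add: F_def q_def N_def power_add mult_ac)
        finally show ?thesis .
      next
        case False
        have "\<epsilon> / (2 * k) = (\<epsilon> / 2) / k" by simp
        also have "\<dots> \<le> q True / l" using qT \<epsilon> kl l by (intro frac_le) auto
        also have "\<dots> = k / (l * (l + k))" by (simp add: q_def N_def add.commute)
        finally have "\<epsilon> / (2 * k) * (real t * (real t - 1) / 2) \<le> k / (l * (l + k)) * (real t * (real t - 1) / 2)"
          by (rule mult_right_mono[OF _ tt])
        then have ex: "exp (2 * s * (s + t) / (l + k) - (k / (l * (l + k))) * (real t * (real t - 1) / 2)) \<le> exp g"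
          unfolding g_def N_def by (simp add: add.commute)
        \<comment> \<open>After swapping the arguments, a book in the second colour is the descent
          lemma with \<open>k\<close> and \<open>l\<close> exchanged.\<close>
        have "binom2 (k - d True) (l - d False) = binom2 (l - t - a False) (k - a True)"
          using False binom2_commute[of "k - a True"] by (simp add: d_def add.commute)
        also have "\<dots> \<le> binom2 l k * (l / (l + k)) ^ (a False + t) * (k / (l + k)) ^ a True
            * exp (2 * s * (s + t) / (l + k) - (k / (l * (l + k))) * (real t * (real t - 1) / 2))"
          using ak asum st k l by (intro binom2_descent) auto
        also have "\<dots> \<le> binom2 l k * (l / (l + k)) ^ (a False + t) * (k / (l + k)) ^ a True * exp g"
          using binom2_pos[of l k] by (intro mult_left_mono ex) auto
        also have "\<dots> = binom2 k l * F * q i ^ t * exp g"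
          using False by (simp add: F_def q_def N_def power_add mult_ac add.commute binom2_commute[of l k])
        finally show ?thesis .
      qed
    qed
    show ?thesis
    proof (rule finish[OF finB, of d])
      show "has_mono E V j (u + d j)" if "has_mono E B j u" for j u
      proof (cases "j = i")
        case True
        have "has_mono E W i (u + card A)"
          using has_mono_book[OF sym AB(1,2) finA AB(3) bspec[OF AB(5)]] that True by simp
        from ext[OF this] show ?thesis using True AB(4) by (simp add: d_def add_ac)
      next
        case False
        then show ?thesis using ext[OF has_mono_subset[OF AB(2) that]] by (simp add: d_def)
      qed
      show "d True \<le> k" "d False \<le> l" using ak by (auto simp: d_def)
      have "binom2 k l * F * q i ^ t * exp g \<le> binom2 k l * F * q i ^ t * exp (- (7 * \<delta> / \<epsilon> * t) - c * k)"
        using g_le binom2_pos[of k l] F q_pos[of i] by (intro mult_left_mono) auto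
      also have "\<dots> = F * (exp (- c * k) * binom2 k l) * (q i ^ t * exp (- (7 * \<delta> / \<epsilon> * t)))"
        by (simp add: exp_diff exp_minus field_simps)
      also have "\<dots> \<le> card W * (q i ^ t * exp (- (7 * \<delta> / \<epsilon> * t)))"
        using W1 q_pos[of i] by (intro mult_right_mono) auto
      also have "\<dots> \<le> card B" using cardB by (simp add: mult_ac)
      finally show "binom2 (k - d True) (l - d False) \<le> card B" using main by linarith
    qed
  qed
qed

section \<open>Choice of constants and rounding\<close>

text \<open>All conditions hold for small \<delta>. Divided by \<delta>, the first has a left side
  of order \<open>sqrt \<delta> * ln (1 / \<delta>)\<close>; in the second the main term is \<delta>
  times the root of \<mu>0, of order \<delta> to the power 1/4. The last two are polynomials in
  \<delta> vanishing at 0.\<close>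

lemma exists_parameter:
  fixes \<epsilon> :: real
  assumes "0 < \<epsilon>"
  obtains \<delta> where "0 < \<delta>" "\<delta> \<le> \<epsilon> / 12" "1 \<le> 1 / (\<delta> * sqrt \<delta>)"
    "2 / (1 / (\<delta> * sqrt \<delta>)) * (ln (1 / \<delta>) + 2) * ln (4 / \<epsilon>) \<le> \<delta> / \<epsilon>"
    "4 * (112 * \<delta> / \<epsilon>\<^sup>2) * (17 + 9 * sqrt (1 / (\<delta> * sqrt \<delta>) + 1))
      + 272 * (112 * \<delta> / \<epsilon>\<^sup>2) / sqrt (1 / (\<delta> * sqrt \<delta>)) * (ln (1 / \<delta>) + 2) \<le> \<epsilon> / 4"
    "(\<delta> * \<epsilon> / 8)\<^sup>2 / 64 + 2 * (\<delta> * \<epsilon> / 8 / 16) * ln (2 / \<epsilon>) \<le> \<epsilon> / 10"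
    "2 * (\<delta> * \<epsilon> / 8 / 16) + 2 * (112 * \<delta> / \<epsilon>\<^sup>2) \<le> \<epsilon> / 2"
proof -
  have lim1: "((\<lambda>\<delta>. 2 * sqrt \<delta> * (ln (1 / \<delta>) + 2)) \<longlongrightarrow> 0) (at_right (0::real))"
    by real_asymp
  have lim2: "((\<lambda>\<delta>. 4 * 112 * \<delta> * (17 + 9 * sqrt (1 / (\<delta> * sqrt \<delta>) + 1))
      + 272 * 112 * \<delta> / sqrt (1 / (\<delta> * sqrt \<delta>)) * (ln (1 / \<delta>) + 2)) \<longlongrightarrow> 0) (at_right (0::real))"
    by real_asymp
  have "((\<lambda>\<delta>. 2 * sqrt \<delta> * (ln (1 / \<delta>) + 2) * ln (4 / \<epsilon>)) \<longlongrightarrow> 0) (at_right 0)"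
    using tendsto_mult_right[OF lim1] by simp
  then have e1: "\<forall>\<^sub>F \<delta> in at_right 0. 2 * sqrt \<delta> * (ln (1 / \<delta>) + 2) * ln (4 / \<epsilon>) < 1 / \<epsilon>"
    by (rule order_tendstoD) (use assms in simp)
  have e2: "\<forall>\<^sub>F \<delta> in at_right 0. 4 * 112 * \<delta> * (17 + 9 * sqrt (1 / (\<delta> * sqrt \<delta>) + 1))
      + 272 * 112 * \<delta> / sqrt (1 / (\<delta> * sqrt \<delta>)) * (ln (1 / \<delta>) + 2) < \<epsilon> * \<epsilon>\<^sup>2 / 4"
    by (rule order_tendstoD(2)[OF lim2]) (use assms in simp)
  have "((\<lambda>\<delta>. (\<delta> * \<epsilon> / 8)\<^sup>2 / 64 + 2 * (\<delta> * \<epsilon> / 8 / 16) * ln (2 / \<epsilon>))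
      \<longlongrightarrow> (0 * \<epsilon> / 8)\<^sup>2 / 64 + 2 * (0 * \<epsilon> / 8 / 16) * ln (2 / \<epsilon>)) (at_right 0)"
    by (intro tendsto_intros) auto
  then have e3: "\<forall>\<^sub>F \<delta> in at_right 0. (\<delta> * \<epsilon> / 8)\<^sup>2 / 64 + 2 * (\<delta> * \<epsilon> / 8 / 16) * ln (2 / \<epsilon>) < \<epsilon> / 10"
    by (rule order_tendstoD) (use assms in simp)
  have "((\<lambda>\<delta>. 2 * (\<delta> * \<epsilon> / 8 / 16) + 2 * (112 * \<delta> / \<epsilon>\<^sup>2))
      \<longlongrightarrow> 2 * (0 * \<epsilon> / 8 / 16) + 2 * (112 * 0 / \<epsilon>\<^sup>2)) (at_right 0)"
    using assms by (intro tendsto_intros) auto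
  then have e4: "\<forall>\<^sub>F \<delta> in at_right 0. 2 * (\<delta> * \<epsilon> / 8 / 16) + 2 * (112 * \<delta> / \<epsilon>\<^sup>2) < \<epsilon> / 2"
    by (rule order_tendstoD) (use assms in simp)
  have e5: "\<forall>\<^sub>F \<delta> in at_right 0. \<delta> < min (\<epsilon> / 12) 1"
    using assms by (intro order_tendstoD(2)[OF tendsto_ident_at]) auto
  have "\<forall>\<^sub>F \<delta> in at_right 0. 0 < \<delta> \<and> 2 * sqrt \<delta> * (ln (1 / \<delta>) + 2) * ln (4 / \<epsilon>) < 1 / \<epsilon> \<and>
      4 * 112 * \<delta> * (17 + 9 * sqrt (1 / (\<delta> * sqrt \<delta>) + 1))
      + 272 * 112 * \<delta> / sqrt (1 / (\<delta> * sqrt \<delta>)) * (ln (1 / \<delta>) + 2) < \<epsilon> * \<epsilon>\<^sup>2 / 4 \<and>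
      (\<delta> * \<epsilon> / 8)\<^sup>2 / 64 + 2 * (\<delta> * \<epsilon> / 8 / 16) * ln (2 / \<epsilon>) < \<epsilon> / 10 \<and>
      2 * (\<delta> * \<epsilon> / 8 / 16) + 2 * (112 * \<delta> / \<epsilon>\<^sup>2) < \<epsilon> / 2 \<and> \<delta> < min (\<epsilon> / 12) 1"
    by (intro eventually_conj e1 e2 e3 e4 e5 eventually_at_right_less)
  from eventually_happens'[OF trivial_limit_at_right_real this]
  obtain \<delta> where \<delta>: "0 < \<delta>" "2 * sqrt \<delta> * (ln (1 / \<delta>) + 2) * ln (4 / \<epsilon>) < 1 / \<epsilon>"
      "4 * 112 * \<delta> * (17 + 9 * sqrt (1 / (\<delta> * sqrt \<delta>) + 1))
      + 272 * 112 * \<delta> / sqrt (1 / (\<delta> * sqrt \<delta>)) * (ln (1 / \<delta>) + 2) < \<epsilon> * \<epsilon>\<^sup>2 / 4"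
      "(\<delta> * \<epsilon> / 8)\<^sup>2 / 64 + 2 * (\<delta> * \<epsilon> / 8 / 16) * ln (2 / \<epsilon>) < \<epsilon> / 10"
      "2 * (\<delta> * \<epsilon> / 8 / 16) + 2 * (112 * \<delta> / \<epsilon>\<^sup>2) < \<epsilon> / 2" "\<delta> < min (\<epsilon> / 12) 1"
    by (elim exE conjE)
  show thesis
  proof (rule that[OF \<delta>(1)])
    show "\<delta> \<le> \<epsilon> / 12" using \<delta>(6) by simp
    have "\<delta> * sqrt \<delta> \<le> 1 * 1" using \<delta>(1,6) by (intro mult_mono) auto
    then show "1 \<le> 1 / (\<delta> * sqrt \<delta>)" using \<delta>(1) by simp
    have "\<delta> * (2 * sqrt \<delta> * (ln (1 / \<delta>) + 2) * ln (4 / \<epsilon>)) \<le> \<delta> * (1 / \<epsilon>)"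
      using \<delta>(1,2) by (intro mult_left_mono) auto
    then show "2 / (1 / (\<delta> * sqrt \<delta>)) * (ln (1 / \<delta>) + 2) * ln (4 / \<epsilon>) \<le> \<delta> / \<epsilon>"
      by (simp add: mult_ac)
    define A where "A = 17 + 9 * sqrt (1 / (\<delta> * sqrt \<delta>) + 1)"
    define B where "B = (ln (1 / \<delta>) + 2) / sqrt (1 / (\<delta> * sqrt \<delta>))"
    have "4 * 112 * \<delta> * A + 272 * 112 * \<delta> * B < \<epsilon> * \<epsilon>\<^sup>2 / 4"
      using \<delta>(3) by (simp add: A_def B_def)
    then have "(4 * 112 * \<delta> * A + 272 * 112 * \<delta> * B) / \<epsilon>\<^sup>2 \<le> (\<epsilon> * \<epsilon>\<^sup>2 / 4) / \<epsilon>\<^sup>2"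
      by (intro divide_right_mono) auto
    also have "\<dots> = \<epsilon> / 4" using assms by simp
    also have "(4 * 112 * \<delta> * A + 272 * 112 * \<delta> * B) / \<epsilon>\<^sup>2
        = 4 * (112 * \<delta> / \<epsilon>\<^sup>2) * A + 272 * (112 * \<delta> / \<epsilon>\<^sup>2) * B"
      by (simp add: add_divide_distrib)
    finally show "4 * (112 * \<delta> / \<epsilon>\<^sup>2) * (17 + 9 * sqrt (1 / (\<delta> * sqrt \<delta>) + 1))
      + 272 * (112 * \<delta> / \<epsilon>\<^sup>2) / sqrt (1 / (\<delta> * sqrt \<delta>)) * (ln (1 / \<delta>) + 2) \<le> \<epsilon> / 4"
      by (simp add: A_def B_def)
  qed (use \<delta> in auto)
qed

lemma ramsey_number_le:
  assumes "0 < n" and "\<And>E. symp E \<Longrightarrow> has_mono E {0..<n} True k \<or> has_mono E {0..<n} False l"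
  shows "ramsey_number k l \<le> n"
proof -
  have "ramsey_prop k l n"
    unfolding ramsey_prop_def
  proof (intro allI impI)
    fix E :: "nat \<Rightarrow> nat \<Rightarrow> bool" assume "\<forall>x y. E x y = E y x"
    then have "symp E" by (auto simp: symp_def)
    from assms(2)[OF this]
    show "(\<exists>S\<subseteq>{0..<n}. card S = k \<and> is_clique E S) \<or> (\<exists>S\<subseteq>{0..<n}. card S = l \<and> is_indep E S)"
      unfolding has_mono_def mono_on_colour_def is_clique_def is_indep_def by simp blast
  qed
  then show ?thesis unfolding ramsey_number_def using assms(1) by (intro Least_le) simp
qed

text \<open>Fixing \<delta> makes \<open>c\<close> and the threshold \<open>M\<close> depend on
  \<epsilon> alone. The bound \<open>c \<le> \<epsilon> / 10\<close> serves the rounding in the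
  theorem, where \<open>exp (- (c * k / 2)) * 2 ^ l\<close> must be at least 2.\<close>

lemma ramsey_exponential_bound:
  fixes \<epsilon> :: real
  assumes "0 < \<epsilon>" "\<epsilon> < 1/2"
  obtains c M :: real where "0 < c" "c \<le> \<epsilon> / 10" "0 \<le> M"
    "\<And>k l V (E :: 'a \<Rightarrow> 'a \<Rightarrow> bool). M \<le> real k \<Longrightarrow> \<epsilon> * k \<le> real l \<Longrightarrow> l \<le> k \<Longrightarrow> finite V \<Longrightarrow> symp E \<Longrightarrow>
       exp (- c * k) * binom2 k l \<le> real (card V) \<Longrightarrow> has_mono E V True (k + 1) \<or> has_mono E V False (l + 1)"
proof -
  obtain \<delta> where \<delta>: "0 < \<delta>" "\<delta> \<le> \<epsilon> / 12" "1 \<le> 1 / (\<delta> * sqrt \<delta>)"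
    "2 / (1 / (\<delta> * sqrt \<delta>)) * (ln (1 / \<delta>) + 2) * ln (4 / \<epsilon>) \<le> \<delta> / \<epsilon>"
    "4 * (112 * \<delta> / \<epsilon>\<^sup>2) * (17 + 9 * sqrt (1 / (\<delta> * sqrt \<delta>) + 1))
      + 272 * (112 * \<delta> / \<epsilon>\<^sup>2) / sqrt (1 / (\<delta> * sqrt \<delta>)) * (ln (1 / \<delta>) + 2) \<le> \<epsilon> / 4"
    "(\<delta> * \<epsilon> / 8)\<^sup>2 / 64 + 2 * (\<delta> * \<epsilon> / 8 / 16) * ln (2 / \<epsilon>) \<le> \<epsilon> / 10"
    "2 * (\<delta> * \<epsilon> / 8 / 16) + 2 * (112 * \<delta> / \<epsilon>\<^sup>2) \<le> \<epsilon> / 2"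
    by (rule exists_parameter[OF assms(1)])
  define \<nu> where "\<nu> = 112 * \<delta> / \<epsilon>\<^sup>2"
  define \<sigma> where "\<sigma> = \<delta> * \<epsilon> / 8 / 16"
  define c where "c = (\<delta> * \<epsilon> / 8)\<^sup>2 / 64"
  define \<mu>0 where "\<mu>0 = 1 / (\<delta> * sqrt \<delta>)"
  have pos: "0 < \<nu>" "0 < \<sigma>" "0 < c" "0 < \<mu>0" using \<delta>(1) assms(1) by (simp_all add: \<nu>_def \<sigma>_def c_def \<mu>0_def)
  \<comment> \<open>A sum of nonnegative thresholds in place of their maximum:
    \<open>M \<le> k\<close> implies each lower bound on \<open>k\<close>.\<close>
  define M where "M = 1 / \<sigma> + \<mu>0 * exp 2 / \<delta> / \<nu> + 2 / \<nu> + 8 / \<epsilon> + 16 / (\<delta> * \<epsilon>) / \<epsilon>"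
  have terms: "0 \<le> 1 / \<sigma>" "0 \<le> \<mu>0 * exp 2 / \<delta> / \<nu>" "0 \<le> 2 / \<nu>" "0 \<le> 8 / \<epsilon>" "0 \<le> 16 / (\<delta> * \<epsilon>) / \<epsilon>"
    using pos \<delta>(1) assms(1) by auto
  have scale: "a \<le> b * k" if "a / b \<le> k" "0 < b" for a b k :: real
    using that by (simp add: pos_divide_le_eq mult.commute)
  have ln2\<epsilon>: "0 \<le> ln (2 / \<epsilon>)" using assms by simp
  show thesis
  proof (rule that[of c M])
    have "0 \<le> 2 * (\<delta> * \<epsilon> / 8 / 16) * ln (2 / \<epsilon>)" using ln2\<epsilon> \<delta>(1) assms(1) by simp
    then show "c \<le> \<epsilon> / 10" using \<delta>(6) unfolding c_def by linarith
    show "0 \<le> M" using terms unfolding M_def by linarith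
    fix k l :: nat and V :: "'a set" and E :: "'a \<Rightarrow> 'a \<Rightarrow> bool"
    assume k: "M \<le> real k" and kl: "\<epsilon> * k \<le> real l" "l \<le> k" and V: "finite V" "symp E"
      "exp (- c * k) * binom2 k l \<le> real (card V)"
    show "has_mono E V True (k + 1) \<or> has_mono E V False (l + 1)"
    proof (rule ramsey_core[where \<nu> = \<nu> and \<eta> = "\<delta> * \<epsilon> / 8" and \<sigma> = \<sigma> and c = c and ?\<mu>0.0 = \<mu>0 and \<delta> = \<delta> and \<epsilon> = \<epsilon>])
      show "1 \<le> \<sigma> * k" "\<mu>0 * exp 2 / \<delta> \<le> \<nu> * k" "2 \<le> \<nu> * k" "8 \<le> \<epsilon> * k" "16 / (\<delta> * \<epsilon>) \<le> \<epsilon> * k"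
        using k terms pos assms(1) unfolding M_def by (intro scale; linarith)+
    qed (use assms \<delta> kl V in \<open>simp_all add: \<nu>_def \<sigma>_def c_def \<mu>0_def\<close>)
  qed (rule pos)
qed

theorem theorem1p2:
  fixes \<epsilon> :: real
  assumes "0 < \<epsilon>" and "\<epsilon> < 1/2"
  shows "\<exists>c::real. c > 0 \<and>
    (\<forall>k l :: nat. 0 < k \<longrightarrow> 0 < l \<longrightarrow>
       \<epsilon> \<le> real l / real k \<longrightarrow> real l / real k \<le> 1 \<longrightarrow> real l \<ge> 1 / c \<longrightarrow>
       real (ramsey_number (k+1) (l+1)) \<le> exp (- c * (ln (real k))^2) * real ((k + l) choose k))"
proof -
  obtain c0 M :: real where c0: "0 < c0" "c0 \<le> \<epsilon> / 10" "0 \<le> M"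
    and bound: "\<And>k l V (E :: nat \<Rightarrow> nat \<Rightarrow> bool). M \<le> real k \<Longrightarrow> \<epsilon> * k \<le> real l \<Longrightarrow> l \<le> k \<Longrightarrow> finite V \<Longrightarrow> symp E \<Longrightarrow>
       exp (- c0 * k) * binom2 k l \<le> real (card V) \<Longrightarrow> has_mono E V True (k + 1) \<or> has_mono E V False (l + 1)"
    by (rule ramsey_exponential_bound[OF assms]) (rule that)
  define R where "R = M + 8 / \<epsilon> + 2 / c0"
  have R: "0 < R" "M \<le> R" "8 / \<epsilon> \<le> R" "2 / c0 \<le> R"
    using assms c0 by (simp_all add: R_def add_nonneg_pos)
  \<comment> \<open>Since \<open>(ln k)\<^sup>2 \<le> 4 * k\<close>, the choice
    \<open>c0 / 8\<close> uses only half of the exponential gain \<open>c0 * k\<close>;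
    \<open>1 / R\<close> makes \<open>l \<ge> 1 / c\<close> force \<open>k \<ge> R\<close>.\<close>
  define c where "c = min (c0 / 8) (1 / R)"
  have c: "0 < c" "c \<le> c0 / 8" "R \<le> 1 / c"
  proof -
    show "0 < c" "c \<le> c0 / 8" using c0 R by (auto simp: c_def)
    have "c \<le> 1 / R" by (simp add: c_def)
    then show "R \<le> 1 / c" using \<open>0 < c\<close> R(1) by (simp add: field_simps)
  qed
  show ?thesis
  proof (intro exI[of _ c] conjI allI impI)
    fix k l :: nat
    assume k: "0 < k" and l: "0 < l" and "\<epsilon> \<le> real l / real k" "real l / real k \<le> 1" "1 / c \<le> real l"
    then have kl: "\<epsilon> * k \<le> l" "l \<le> k" and Rk: "R \<le> k"
      using c(3) by (simp_all add: field_simps)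
    have "8 / \<epsilon> \<le> k" "2 / c0 \<le> k" using R Rk by linarith+
    then have \<epsilon>k: "8 \<le> \<epsilon> * k" and c0k: "2 \<le> c0 * k"
      using assms c0 by (simp_all add: field_simps)
    define x where "x = exp (- c * (ln (real k))\<^sup>2) * real ((k + l) choose k)"
    have "(ln (real k))\<^sup>2 \<le> 4 * k"
    proof -
      have "ln (real k) = 2 * ln (sqrt k)" using k by (simp add: ln_sqrt)
      also have "\<dots> \<le> 2 * sqrt k" using k ln_le_minus_one[of "sqrt k"] by simp
      finally have "(ln (real k))\<^sup>2 \<le> (2 * sqrt k)\<^sup>2" using k by (intro power_mono) auto
      then show ?thesis by (simp add: power_mult_distrib)
    qed
    then have "c * (ln (real k))\<^sup>2 \<le> (c0 / 8) * (4 * k)" using c by (intro mult_mono) auto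
    then have ck: "c * (ln (real k))\<^sup>2 \<le> c0 * k / 2" by simp
    have x_ge: "exp (- (c0 * k / 2)) * binom2 k l \<le> x"
      unfolding x_def binom2_def using ck by (intro mult_right_mono) auto
    have "2 \<le> exp (1::real)" using exp_ge_add_one_self[of "1::real"] by simp
    also have "exp 1 \<le> exp (- (c0 * k / 2) + l * ln 2)"
    proof -
      have "c0 * k \<le> \<epsilon> / 10 * k" using c0 by (intro mult_right_mono) auto
      moreover have "(\<epsilon> * k) * (2 / 3) \<le> l * ln 2"
        using kl assms ln2_ge_two_thirds by (intro mult_mono) auto
      ultimately show ?thesis using \<epsilon>k by simp
    qed
    also have "\<dots> = exp (- (c0 * k / 2)) * 2 ^ l"
      unfolding exp_add by (simp add: exp_of_nat_mult)
    also have "\<dots> \<le> exp (- (c0 * k / 2)) * binom2 k l"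
      using binom2_ge_power[OF l kl(2)] by (intro mult_left_mono) auto
    finally have x2: "2 \<le> x" using x_ge by linarith
    \<comment> \<open>The number of vertices must be an integer not above \<open>x\<close>. For
      \<open>x \<ge> 2\<close> the floor loses at most a factor 2, absorbed by the spare
      \<open>exp (- (c0 * k / 2)) \<le> 1 / 2\<close>.\<close>
    define n where "n = nat \<lfloor>x\<rfloor>"
    have n: "n \<le> x" "x / 2 \<le> n" "0 < n" using x2 unfolding n_def by linarith+
    have "exp (- c0 * k) * binom2 k l \<le> n"
    proof -
      have "exp (- c0 * k) = exp (- (c0 * k / 2)) * exp (- (c0 * k / 2))"
        by (simp flip: exp_add)
      also have "\<dots> \<le> exp (- (c0 * k / 2)) * (1 / 2)"
      proof (intro mult_left_mono)
        have "exp (- (c0 * k / 2)) \<le> exp (- 1)" using c0k by simp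
        also have "\<dots> \<le> 1 / 2" using \<open>2 \<le> exp 1\<close> by (simp add: exp_minus field_simps)
        finally show "exp (- (c0 * k / 2)) \<le> 1 / 2" .
      qed simp
      finally have "exp (- c0 * k) * binom2 k l \<le> exp (- (c0 * k / 2)) * (1 / 2) * binom2 k l"
        using binom2_pos[of k l] by (intro mult_right_mono) auto
      also have "\<dots> \<le> x / 2" using x_ge by simp
      finally show ?thesis using n(2) by linarith
    qed
    then have "ramsey_number (k + 1) (l + 1) \<le> n"
      using bound[of k l "{0..<n}"] R(2) Rk kl n(3) by (intro ramsey_number_le) auto
    then show "real (ramsey_number (k+1) (l+1)) \<le> exp (- c * (ln (real k))^2) * real ((k + l) choose k)"
      using n(1) unfolding x_def by linarith
  qed (rule c(1))
qed

end
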